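(* Let $\Bbbk$ be an infinite field, let $n, s, d_1,\ldots,d_s$ be positive integers, let $r_j=\binom{n+d_j-1}{d_j}$, and let $\bar{x}=\{x_1,\ldots,x_n\}$ and $\bar{t}=\{t_{j,k} \mid 1\le j\le s,\ 1\le k\le r_j\}$ be sets of variables. Let $I'$ be the ideal of $\Bbbk[\bar{t},\bar{x}]$ generated by $$F_j = t_{j,1}x_1^{d_j}+t_{j,2}x_1^{d_j-1}x_2+\cdots+t_{j,r_j}x_n^{d_j}\qquad (1\le j\le s),$$ where in $F_j$ every monomial of degree $d_j$ in $\bar{x}$ occurs exactly once, with its own parameter as coefficient. Let $\preceq'$ be an inverse block monomial order on the monomials in $\bar{t}\cup\bar{x}$, let $\preceq$ be its restriction to the monomials in $\bar{x}$, where $x_1\succeq\cdots\succeq x_n$, and let $\mathcal{G}$ be a Gröbner basis of $I'$ with respect to $\preceq'$. Then the monomial ideal of $\Bbbk[\bar{x}]$ generated by $\{\operatorname{LM}_{\preceq}(g)\mid g\in\mathcal{G}\}$ coincides with the initial ideal of $V$-generic ideals with respect to $\preceq$ (that is, with the common monomial ideal $\operatorname{in}_{\preceq}(I_{\mathbf{a}})$, $\mathbf{a}\in V$).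
   Context: Inverse block order. Given monomial orders $\preceq_{\bar{t}}$ on the monomials in $\bar{t}$ and $\preceq$ on the monomials in $\bar{x}$, the inverse block monomial order $\preceq'$ on the monomials in $\bar{t}\cup\bar{x}$ is defined, for monomials $u_1,u_2$ in $\bar{t}$ and $v_1,v_2$ in $\bar{x}$, by: $u_1v_1\preceq' u_2v_2$ iff $v_1\prec v_2$, or $v_1=v_2$ and $u_1\preceq_{\bar{t}}u_2$. For nonzero $F\in\Bbbk[\bar{t},\bar{x}]$, regarded as an element of $\Bbbk[\bar{t}][\bar{x}]$, $\operatorname{LM}_{\preceq}(F)$ denotes its leading monomial in $\bar{x}$ with respect to $\preceq$. A Gröbner basis is a finite set of nonzero elements of the ideal whose initial terms generate the initial ideal. Parametrization. $S = \Bbbk[x_1,\ldots,x_n] = \bigoplus_{d\ge 0} S_d$ is graded with $\deg x_i = 1$. Let $N = \sum_{j=1}^s r_j$. A point $\mathbf{a} = (a_{j,k}) \in \mathbb{A}_{\Bbbk}^N = \Bbbk^N$ corresponds to the homogeneous ideal $I_{\mathbf{a}} = (f_1,\ldots,f_s) \subset S$, where $f_j$ is obtained from $F_j$ by substituting $t_{j,k}=a_{j,k}$. The set $U$. For each $d \ge 0$ let $t_d = \max_{\mathbf{a}} \dim_{\Bbbk} (I_{\mathbf{a}})_d$ (maximum over all $\mathbf{a}\in\mathbb{A}_{\Bbbk}^N$), let $U_d = \{\mathbf{a} : \dim_{\Bbbk}(I_{\mathbf{a}})_d = t_d\}$, and let $U = \bigcap_{d\ge 0} U_d$. It is known that $U$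 is a Zariski open dense subset of $\mathbb{A}_{\Bbbk}^N$. The set $V$ (depending on $\preceq$). For an ideal $I$, $\operatorname{in}_{\preceq}(I)$ is the ideal spanned over $\Bbbk$ by the initial terms $\operatorname{in}_{\preceq}(f)$, $f \in I$. For each $d$, a standard exterior monomial is an element $m_1\wedge\cdots\wedge m_{t_d}$ of $\bigwedge^{t_d} S_d$ with $m_1 \succ \cdots \succ m_{t_d}$ monomials of degree $d$; these are ordered lexicographically: $m_1\wedge\cdots\wedge m_{t_d} \ge m_1'\wedge\cdots\wedge m_{t_d}'$ iff they are equal or $m_i \succeq m_i'$ for the smallest $i$ with $m_i\ne m_i'$. For $\mathbf{a}\in U_d$, the monomials in $\operatorname{in}_{\preceq}(I_{\mathbf{a}})_d$ form one standard exterior monomial, which spans $\bigwedge^{t_d}\operatorname{in}_{\preceq}(I_{\mathbf{a}})_d$; let $m^{(d)}$ be the largest one obtained as $\mathbf{a}$ ranges over $U_d$. Let $V_d\subset U_d$ be the set of $\mathbf{a} \in U_d$ for which this standard exterior monomial equals $m^{(d)}$, and let $V = \bigcap_{d\ge0} V_d$. It is known that $V \subset U$ is a Zariski open dense subset of $\mathbb{A}_{\Bbbk}^N$; by construction $\operatorname{in}_{\preceq}(I_{\mathbf{a}})$ is the same for all $\mathbf{a}\in V$. The ideals $I_{\mathbf{a}}$ with $\mathbf{a}\in V$ are called $V$-generic ideals. *)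

theory Defs
  imports Complex_Main "HOL-Library.Poly_Mapping" "HOL-Library.FuncSet"
begin

section \<open>Variables, monomials, polynomials\<close>

text \<open>All polynomials live in one type, over the variables \<open>TVar j k\<close> (for $t_{j,k}$) and
  \<open>XVar i\<close> (for $x_i$). The polynomial ring in a set \<open>W\<close> of variables is the subset \<open>polys W\<close>.
  Monomials are exponent vectors, hence the product of monomials is \<open>+\<close>.\<close>

datatype var = TVar nat nat | XVar nat

type_synonym mono = "var \<Rightarrow>\<^sub>0 nat"
type_synonym 'k mpoly = "mono \<Rightarrow>\<^sub>0 'k"

abbreviation lookup where "lookup \<equiv> Poly_Mapping.lookup"
abbreviation keys where "keys \<equiv> Poly_Mapping.keys"
abbreviation single where "single \<equiv> Poly_Mapping.single"

definition monomials :: "var set \<Rightarrow> mono set" where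
  "monomials W = {m. keys m \<subseteq> W}"

definition polys :: "var set \<Rightarrow> 'k::comm_ring_1 mpoly set" where
  "polys W = {p. keys p \<subseteq> monomials W}"

definition mdeg :: "mono \<Rightarrow> nat" where
  "mdeg m = (\<Sum>y\<in>keys m. lookup m y)"

definition monomials_deg :: "var set \<Rightarrow> nat \<Rightarrow> mono set" where
  "monomials_deg W d = {m \<in> monomials W. mdeg m = d}"

definition homog :: "var set \<Rightarrow> nat \<Rightarrow> 'k::comm_ring_1 mpoly set" where
  "homog W d = {p. keys p \<subseteq> monomials_deg W d}"

definition ideal_gen :: "var set \<Rightarrow> 'k::comm_ring_1 mpoly set \<Rightarrow> 'k mpoly set" where
  "ideal_gen W G = {(\<Sum>g\<in>A. q g * g) | A q. finite A \<and> A \<subseteq> G \<and> q ` A \<subseteq> polys W}"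

definition scale :: "'k::field \<Rightarrow> 'k mpoly \<Rightarrow> 'k mpoly" where
  "scale c p = Poly_Mapping.map ((*) c) p"

global_interpretation kspace: vector_space "scale :: 'k::field \<Rightarrow> 'k mpoly \<Rightarrow> 'k mpoly"
  defines kspan = kspace.span and kdim = kspace.dim
proof -
  have s: "scale c p = single 0 c * p" for c :: 'k and p
    by (simp add: scale_def mult_map_scale_conv_mult)
  show "vector_space (scale :: 'k \<Rightarrow> 'k mpoly \<Rightarrow> 'k mpoly)"
    by unfold_locales (simp_all add: s distrib_left distrib_right single_add mult_single
        flip: mult.assoc)
qed


section \<open>Monomial orders, initial ideals, Groebner bases\<close>

text \<open>An order \<open>\<preceq>\<close> is the set of pairs \<open>(u, v)\<close> with \<open>u \<preceq> v\<close>.\<close>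

definition monomial_order :: "var set \<Rightarrow> mono rel \<Rightarrow> bool" where
  "monomial_order W r \<longleftrightarrow> well_order_on (monomials W) r \<and>
     (\<forall>u\<in>monomials W. \<forall>v\<in>monomials W. \<forall>w\<in>monomials W. (u, v) \<in> r \<longrightarrow> (u + w, v + w) \<in> r)"

definition inverse_block_order :: "var set \<Rightarrow> var set \<Rightarrow> mono rel \<Rightarrow> mono rel \<Rightarrow> mono rel" where
  "inverse_block_order T X rt rx = {(u1 + v1, u2 + v2) | u1 v1 u2 v2.
     u1 \<in> monomials T \<and> u2 \<in> monomials T \<and> v1 \<in> monomials X \<and> v2 \<in> monomials X \<and>
     ((v1, v2) \<in> rx \<and> v1 \<noteq> v2 \<or> v1 = v2 \<and> (u1, u2) \<in> rt)}"

lemma inverse_block_order_restrict: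
  assumes "T \<inter> X = {}" "monomial_order T rt" "monomial_order X rx"
  shows "Restr (inverse_block_order T X rt rx) (monomials X) = rx"
proof -
  have key: "u = 0" if "u \<in> monomials T" "u + v \<in> monomials X" for u v :: mono
  proof -
    have "keys u \<subseteq> keys (u + v)"
      by (auto simp: in_keys_iff lookup_add)
    then have "keys u \<subseteq> T \<inter> X"
      using that by (auto simp: monomials_def)
    then show ?thesis using assms(1) by (simp add: poly_mapping_eqI in_keys_iff subset_iff)
  qed
  have z: "0 \<in> monomials T" by (simp add: monomials_def)
  have t: "(0, 0) \<in> rt" "refl_on (monomials X) rx" "rx \<subseteq> monomials X \<times> monomials X"
    using assms(2,3) z by (auto simp: monomial_order_def order_on_defs refl_on_def)
  show ?thesis
  proof (intro equalityI subrelI)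
    fix v v' assume "(v, v') \<in> Restr (inverse_block_order T X rt rx) (monomials X)"
    then obtain u1 v1 u2 v2 where *: "v = u1 + v1" "v' = u2 + v2" "u1 \<in> monomials T"
        "u2 \<in> monomials T" "v1 \<in> monomials X" "(v1, v2) \<in> rx \<or> v1 = v2"
        "v \<in> monomials X" "v' \<in> monomials X"
      unfolding inverse_block_order_def by blast
    then have "u1 = 0" "u2 = 0" using key by blast+
    then show "(v, v') \<in> rx" using * t(2) by (auto simp: refl_on_def)
  next
    fix v v' assume *: "(v, v') \<in> rx"
    then have "v \<in> monomials X" "v' \<in> monomials X" using t(3) by auto
    moreover have "(0 + v, 0 + v') \<in> inverse_block_order T X rt rx"
      unfolding inverse_block_order_def using calculation * z t(1) by blast
    ultimately show "(v, v') \<in> Restr (inverse_block_order T X rt rx) (monomials X)" by simp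
  qed
qed

definition greatest :: "mono rel \<Rightarrow> mono set \<Rightarrow> mono" where
  "greatest r A = (THE m. m \<in> A \<and> (\<forall>m'\<in>A. (m', m) \<in> r))"

definition init_term :: "mono rel \<Rightarrow> 'k::comm_ring_1 mpoly \<Rightarrow> 'k mpoly" where
  "init_term r p = single (greatest r (keys p)) (lookup p (greatest r (keys p)))"

definition initial_ideal :: "mono rel \<Rightarrow> 'k::field mpoly set \<Rightarrow> 'k mpoly set" where
  "initial_ideal r I = kspan (init_term r ` (I - {0}))"

definition groebner_basis ::
    "var set \<Rightarrow> mono rel \<Rightarrow> 'k::field mpoly set \<Rightarrow> 'k mpoly set \<Rightarrow> bool" where
  "groebner_basis W r I G \<longleftrightarrow> finite G \<and> G \<subseteq> I - {0} \<and>
     ideal_gen W (init_term r ` G) = initial_ideal r I"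


section \<open>Polynomials in t and x as polynomials in x over k[t]\<close>

definition restrict_mono :: "var set \<Rightarrow> mono \<Rightarrow> mono" where
  "restrict_mono W m = Poly_Mapping.mapp (\<lambda>y e. e when y \<in> W) m"

definition xpart :: "mono \<Rightarrow> mono" where
  "xpart m = restrict_mono (range XVar) m"

definition tpart :: "mono \<Rightarrow> mono" where
  "tpart m = restrict_mono (- range XVar) m"

text \<open>The coefficient in $k[t]$ of the monomial \<open>v\<close> in $x$.\<close>

definition x_coeff :: "'k::comm_ring_1 mpoly \<Rightarrow> mono \<Rightarrow> 'k mpoly" where
  "x_coeff p v = (\<Sum>m\<in>{m \<in> keys p. xpart m = v}. single (tpart m) (lookup p m))"

definition LM_x :: "mono rel \<Rightarrow> 'k::comm_ring_1 mpoly \<Rightarrow> mono" where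
  "LM_x rx p = greatest rx {v. x_coeff p v \<noteq> 0}"

text \<open>Substitution of \<open>a (j, k)\<close> for \<open>TVar j k\<close>.\<close>

definition specialize :: "(nat \<times> nat \<Rightarrow> 'k) \<Rightarrow> 'k::comm_ring_1 mpoly \<Rightarrow> 'k mpoly" where
  "specialize a p = (\<Sum>m\<in>keys p. single (xpart m)
     (lookup p m * (\<Prod>y\<in>keys m. case y of TVar j k \<Rightarrow> a (j, k) ^ lookup m y | XVar i \<Rightarrow> 1)))"


section \<open>Generic forms and the parameter space\<close>

definition xvars :: "nat \<Rightarrow> var set" where
  "xvars n = XVar ` {1..n}"

definition num_params :: "nat \<Rightarrow> (nat \<Rightarrow> nat) \<Rightarrow> nat \<Rightarrow> nat" where
  "num_params n d j = (n + d j - 1) choose (d j)"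

definition param_index :: "nat \<Rightarrow> nat \<Rightarrow> (nat \<Rightarrow> nat) \<Rightarrow> (nat \<times> nat) set" where
  "param_index n s d = (SIGMA j:{1..s}. {1..num_params n d j})"

definition tvars :: "nat \<Rightarrow> nat \<Rightarrow> (nat \<Rightarrow> nat) \<Rightarrow> var set" where
  "tvars n s d = (\<lambda>(j, k). TVar j k) ` param_index n s d"

text \<open>\<open>e j\<close> enumerates the monomials of degree \<open>d j\<close> in $x$: the monomial \<open>e j k\<close> has
  the parameter $t_{j,k}$ as its coefficient. No particular enumeration is prescribed.\<close>

definition enumerates_monomials :: "nat \<Rightarrow> nat \<Rightarrow> (nat \<Rightarrow> nat) \<Rightarrow> (nat \<Rightarrow> nat \<Rightarrow> mono) \<Rightarrow> bool" where
  "enumerates_monomials n s d e \<longleftrightarrow>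
     (\<forall>j\<in>{1..s}. bij_betw (e j) {1..num_params n d j} (monomials_deg (xvars n) (d j)))"

definition generic_form ::
    "nat \<Rightarrow> (nat \<Rightarrow> nat) \<Rightarrow> (nat \<Rightarrow> nat \<Rightarrow> mono) \<Rightarrow> nat \<Rightarrow> 'k::comm_ring_1 mpoly" where
  "generic_form n d e j = (\<Sum>k=1..num_params n d j. single (single (TVar j k) 1 + e j k) 1)"

definition generic_ideal ::
    "nat \<Rightarrow> nat \<Rightarrow> (nat \<Rightarrow> nat) \<Rightarrow> (nat \<Rightarrow> nat \<Rightarrow> mono) \<Rightarrow> 'k::comm_ring_1 mpoly set" where
  "generic_ideal n s d e =
     ideal_gen (tvars n s d \<union> xvars n) (generic_form n d e ` {1..s})"

definition param_space :: "nat \<Rightarrow> nat \<Rightarrow> (nat \<Rightarrow> nat) \<Rightarrow> (nat \<times> nat \<Rightarrow> 'k) set" where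
  "param_space n s d = param_index n s d \<rightarrow>\<^sub>E UNIV"

definition spec_ideal :: "nat \<Rightarrow> nat \<Rightarrow> (nat \<Rightarrow> nat) \<Rightarrow> (nat \<Rightarrow> nat \<Rightarrow> mono) \<Rightarrow>
    (nat \<times> nat \<Rightarrow> 'k) \<Rightarrow> 'k::comm_ring_1 mpoly set" where
  "spec_ideal n s d e a =
     ideal_gen (xvars n) ((\<lambda>j. specialize a (generic_form n d e j)) ` {1..s})"


section \<open>The set V\<close>

text \<open>These are defined for an arbitrary family \<open>I\<close> of ideals of $k[x_1,\dots,x_n]$, indexed by
  a set \<open>P\<close> of points.\<close>

definition max_dim :: "nat \<Rightarrow> 'p set \<Rightarrow> ('p \<Rightarrow> 'k::field mpoly set) \<Rightarrow> nat \<Rightarrow> nat" where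
  "max_dim n P I d = Max ((\<lambda>a. kdim (I a \<inter> homog (xvars n) d)) ` P)"

definition U_deg :: "nat \<Rightarrow> 'p set \<Rightarrow> ('p \<Rightarrow> 'k::field mpoly set) \<Rightarrow> nat \<Rightarrow> 'p set" where
  "U_deg n P I d = {a \<in> P. kdim (I a \<inter> homog (xvars n) d) = max_dim n P I d}"

text \<open>The standard exterior monomial $m_1 \wedge \dots \wedge m_t$ of degree \<open>d\<close> is represented
  by the strictly decreasing list of its factors.\<close>

definition std_ext_monomials :: "nat \<Rightarrow> mono rel \<Rightarrow> nat \<Rightarrow> nat \<Rightarrow> mono list set" where
  "std_ext_monomials n rx d t = {ms. length ms = t \<and> set ms \<subseteq> monomials_deg (xvars n) d \<and>
     sorted_wrt (\<lambda>u v. (v, u) \<in> rx \<and> u \<noteq> v) ms}"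

text \<open>The lexicographic order on lists of the same length.\<close>

definition ext_ge :: "mono rel \<Rightarrow> mono list \<Rightarrow> mono list \<Rightarrow> bool" where
  "ext_ge rx ms ms' \<longleftrightarrow> ms = ms' \<or>
     (\<exists>i<length ms. (\<forall>l<i. ms ! l = ms' ! l) \<and> ms ! i \<noteq> ms' ! i \<and> (ms' ! i, ms ! i) \<in> rx)"

text \<open>For \<open>a\<close> in \<open>U_deg n P I d\<close>, the exterior monomial formed by all the monomials of degree \<open>d\<close>
  in the initial ideal of \<open>I a\<close>; it spans the top exterior power of the degree \<open>d\<close> part.\<close>

definition init_ext_mono ::
    "nat \<Rightarrow> mono rel \<Rightarrow> 'p set \<Rightarrow> ('p \<Rightarrow> 'k::field mpoly set) \<Rightarrow> nat \<Rightarrow> 'p \<Rightarrow> mono list" where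
  "init_ext_mono n rx P I d a = (THE ms. ms \<in> std_ext_monomials n rx d (max_dim n P I d) \<and>
     set ms = {m \<in> monomials_deg (xvars n) d. single m 1 \<in> initial_ideal rx (I a)})"

definition max_ext_mono ::
    "nat \<Rightarrow> mono rel \<Rightarrow> 'p set \<Rightarrow> ('p \<Rightarrow> 'k::field mpoly set) \<Rightarrow> nat \<Rightarrow> mono list" where
  "max_ext_mono n rx P I d = (THE ms. ms \<in> init_ext_mono n rx P I d ` U_deg n P I d \<and>
     (\<forall>ms' \<in> init_ext_mono n rx P I d ` U_deg n P I d. ext_ge rx ms ms'))"

definition V_deg ::
    "nat \<Rightarrow> mono rel \<Rightarrow> 'p set \<Rightarrow> ('p \<Rightarrow> 'k::field mpoly set) \<Rightarrow> nat \<Rightarrow> 'p set" where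
  "V_deg n rx P I d = {a \<in> U_deg n P I d. init_ext_mono n rx P I d a = max_ext_mono n rx P I d}"

definition V_set :: "nat \<Rightarrow> mono rel \<Rightarrow> 'p set \<Rightarrow> ('p \<Rightarrow> 'k::field mpoly set) \<Rightarrow> 'p set" where
  "V_set n rx P I = (\<Inter>d. V_deg n rx P I d)"

definition V_generic :: "nat \<Rightarrow> nat \<Rightarrow> (nat \<Rightarrow> nat) \<Rightarrow> (nat \<Rightarrow> nat \<Rightarrow> mono) \<Rightarrow> mono rel \<Rightarrow>
    (nat \<times> nat \<Rightarrow> 'k::field) set" where
  "V_generic n s d e rx = V_set n rx (param_space n s d) (spec_ideal n s d e)"

end

(*
Let M be the monomial ideal generated by the LM(g), g in G. Because x dominates t, the leading monomial
in x of every nonzero element of I' lies in M. If the leading coefficients (in k[t]) of the elements of G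
do not vanish at a, which happens for some a since k is infinite, then specialization gives
M <= in(I_a). Conversely, for every point a, degree D and monomial m, in(I_a) has at most as many
monomials of degree D above m as M: lifting elements of I_a with these leading monomials to I' gives a
matrix over k[t] whose determinant does not vanish at a, hence does not vanish; so if M had fewer
monomials above m, a combination of the lifts with coefficients in k[t] would have a leading monomial
outside M. Taking m minimal, this bounds the dimension of every (I_a)_D, and for general m it says that
the exterior monomial of M is lexicographically the largest. Hence V consists exactly of the points a
with in(I_a) = M, and it is nonempty.
*)
theory Submission
  imports Defs "Jordan_Normal_Form.Determinant" "HOL-Library.Nat_Bijection"
begin

hide_const (open) Order.greatest

text \<open>Specializing a lift may kill its leading coefficient, so the leading monomial in x of a
  lift can lie far above that of the element of I_a which it lifts. Hence no inclusion between
  in(I_a) and M can be read off at an arbitrary point. What passes from a back to k[t] is the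
  nonvanishing of a determinant, and this controls only the number of leading monomials; this is why
  the comparison at every point is one of cardinalities, made above each m so that it determines the
  lexicographic order as well as the dimension. The leading monomial of a combination is kept in a
  fixed degree D because the F_j are homogeneous in x: the component of degree D in x of an element
  of I' is again in I'. All rings sit in one type with infinitely many variables, an integral
  domain; determinants are taken there, and solutions over k[t] are recovered afterwards by taking
  coefficients.\<close>

primrec var_code :: "var \<Rightarrow> nat" where
  "var_code (TVar j k) = 2 * prod_encode (j, k)"
| "var_code (XVar i) = Suc (2 * i)"

text \<open>Parity separates the two constructors, and \<open>prod_encode\<close> is
  injective.\<close>

lemma inj_var_code: "inj var_code"
proof (rule injI)
  fix x y assume "var_code x = var_code y"
  then show "x = y"
    by (cases x; cases y) (simp_all, (presburger | metis Suc_double_not_eq_double double_not_eq_Suc_double)+)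
qed

text \<open>Any linear order on the variables will do: it makes the type of monomials a linearly ordered
  cancellative monoid, hence the type of polynomials an integral domain.\<close>

instantiation var :: linorder
begin

definition less_eq_var :: "var \<Rightarrow> var \<Rightarrow> bool" where
  "x \<le> y \<longleftrightarrow> var_code x \<le> var_code y"

definition less_var :: "var \<Rightarrow> var \<Rightarrow> bool" where
  "x < y \<longleftrightarrow> var_code x < var_code y"

instance
  by standard (auto simp: less_eq_var_def less_var_def dest: injD[OF inj_var_code])

end

section \<open>Polynomials as sums of terms\<close>

lemma sum_terms: "(\<Sum>m\<in>keys p. single m (lookup p m)) = p"
  by (rule poly_mapping_eqI) (auto simp: lookup_sum lookup_single when_def in_keys_iff)

text \<open>Reduces additive claims to single terms. The premise \<open>m \<in> keys p\<close> keeps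
  side conditions such as \<open>p \<in> polys W\<close> usable in the case of a term.\<close>

lemma terms_induct [case_names zero single add]:
  fixes p :: "'a \<Rightarrow>\<^sub>0 'b::comm_monoid_add"
  assumes "P 0" "\<And>m c. m \<in> keys p \<Longrightarrow> P (single m c)" "\<And>p q. P p \<Longrightarrow> P q \<Longrightarrow> P (p + q)"
  shows "P p"
proof -
  have "P (\<Sum>m\<in>A. single m (lookup p m))" if "finite A" "A \<subseteq> keys p" for A
    using that by (induction A rule: finite_induct) (auto intro: assms)
  from this[of "keys p"] show ?thesis by (simp add: sum_terms)
qed

lemma single_eq_0_iff [simp]: "single m c = 0 \<longleftrightarrow> c = 0"
  by (metis lookup_single_eq lookup_zero single_zero)

lemma monomials_add: "u \<in> monomials W \<Longrightarrow> v \<in> monomials W \<Longrightarrow> u + v \<in> monomials W"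
  using Poly_Mapping.keys_add[of u v] by (auto simp: monomials_def)

lemma zero_in_monomials [simp]: "0 \<in> monomials W"
  by (simp add: monomials_def)

lemma monomials_mono: "V \<subseteq> W \<Longrightarrow> monomials V \<subseteq> monomials W"
  by (auto simp: monomials_def)

lemma polys_mono: "V \<subseteq> W \<Longrightarrow> polys V \<subseteq> polys W"
  by (auto simp: polys_def dest: monomials_mono)

lemma polys_zero [simp]: "0 \<in> polys W"
  by (simp add: polys_def)

lemma polys_single: "m \<in> monomials W \<Longrightarrow> single m c \<in> polys W"
  by (simp add: polys_def)

lemma polys_add: "p \<in> polys W \<Longrightarrow> q \<in> polys W \<Longrightarrow> p + q \<in> polys W"
  using Poly_Mapping.keys_add[of p q] by (auto simp: polys_def)

lemma polys_mult: "p \<in> polys W \<Longrightarrow> q \<in> polys W \<Longrightarrow> p * q \<in> polys W"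
  using Poly_Mapping.keys_mult[of p q] monomials_add by (fastforce simp: polys_def)

lemma polys_sum: "(\<And>i. i \<in> A \<Longrightarrow> f i \<in> polys W) \<Longrightarrow> sum f A \<in> polys W"
  by (induction A rule: infinite_finite_induct) (simp_all add: polys_add)

section \<open>Ideals\<close>

lemma ideal_genI:
  assumes "finite A" "A \<subseteq> G" "q ` A \<subseteq> polys W" "p = (\<Sum>g\<in>A. q g * g)"
  shows "p \<in> ideal_gen W G"
  unfolding ideal_gen_def by (rule CollectI, rule exI[of _ A], rule exI[of _ q]) (use assms in auto)

lemma ideal_gen_zero: "0 \<in> ideal_gen W G"
  by (rule ideal_genI[of "{}"]) auto

lemma ideal_gen_gen_mult:
  assumes "q \<in> polys W" "g \<in> G"
  shows "q * g \<in> ideal_gen W G"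
  by (rule ideal_genI[of "{g}" _ "\<lambda>_. q"]) (use assms in auto)

lemma ideal_gen_add:
  assumes "p \<in> ideal_gen W G" "q \<in> ideal_gen W G"
  shows "p + q \<in> ideal_gen W G"
proof -
  obtain A r where p: "p = (\<Sum>g\<in>A. r g * g)" "finite A" "A \<subseteq> G" "r ` A \<subseteq> polys W"
    using assms(1) unfolding ideal_gen_def by blast
  obtain B r' where q: "q = (\<Sum>g\<in>B. r' g * g)" "finite B" "B \<subseteq> G" "r' ` B \<subseteq> polys W"
    using assms(2) unfolding ideal_gen_def by blast
  \<comment> \<open>The two representations may use different generators; the cofactors of each are
    extended by zero to the union.\<close>
  define t where "t = (\<lambda>g. (if g \<in> A then r g else 0) + (if g \<in> B then r' g else 0))"
  have "p = (\<Sum>g\<in>A \<union> B. (if g \<in> A then r g else 0) * g)"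
    unfolding p(1) by (intro sum.mono_neutral_cong_left) (use p(2) q(2) in auto)
  moreover have "q = (\<Sum>g\<in>A \<union> B. (if g \<in> B then r' g else 0) * g)"
    unfolding q(1) by (intro sum.mono_neutral_cong_left) (use p(2) q(2) in auto)
  ultimately have "p + q = (\<Sum>g\<in>A \<union> B. t g * g)"
    by (simp only: t_def distrib_right sum.distrib)
  moreover have "t ` (A \<union> B) \<subseteq> polys W"
    using p(4) q(4) by (auto simp: t_def image_subset_iff intro!: polys_add)
  moreover have "finite (A \<union> B)" "A \<union> B \<subseteq> G" using p q by auto
  ultimately show ?thesis by (intro ideal_genI[of "A \<union> B" G t])
qed

lemma ideal_gen_mult:
  assumes "r \<in> polys W" "p \<in> ideal_gen W G"
  shows "r * p \<in> ideal_gen W G"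
proof -
  obtain A q where p: "p = (\<Sum>g\<in>A. q g * g)" "finite A" "A \<subseteq> G" "q ` A \<subseteq> polys W"
    using assms(2) unfolding ideal_gen_def by blast
  have "r * p = (\<Sum>g\<in>A. (\<lambda>g. r * q g) g * g)"
    by (simp add: p(1) sum_distrib_left mult.assoc)
  moreover have "(\<lambda>g. r * q g) ` A \<subseteq> polys W" using p(4) assms(1) by (auto intro: polys_mult)
  ultimately show ?thesis using p(2,3) by (intro ideal_genI[of A G "\<lambda>g. r * q g"])
qed

lemma ideal_gen_sum: "(\<And>i. i \<in> A \<Longrightarrow> f i \<in> ideal_gen W G) \<Longrightarrow> sum f A \<in> ideal_gen W G"
  by (induction A rule: infinite_finite_induct) (simp_all add: ideal_gen_add ideal_gen_zero)

text \<open>Cofactors are themselves sums of terms, so additive claims about an ideal need checking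
  only on multiples of generators by one term.\<close>

lemma ideal_gen_induct [consumes 1, case_names zero add mult]:
  assumes p: "p \<in> ideal_gen W G"
    and zero: "P 0"
    and add: "\<And>p q. P p \<Longrightarrow> P q \<Longrightarrow> P (p + q)"
    and t: "\<And>m c g. m \<in> monomials W \<Longrightarrow> g \<in> G \<Longrightarrow> P (single m c * g)"
  shows "P p"
proof -
  have 1: "P (q * g)" if "q \<in> polys W" "g \<in> G" for q g
    by (induction q rule: terms_induct)
      (use that in \<open>auto simp: polys_def distrib_right intro: zero add t\<close>)
  obtain A q where p: "p = (\<Sum>g\<in>A. q g * g)" "finite A" "A \<subseteq> G" "q ` A \<subseteq> polys W"
    using p unfolding ideal_gen_def by blast
  have "P (\<Sum>g\<in>B. q g * g)" if "finite B" "B \<subseteq> A" for B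
    using that
  proof (induction B rule: finite_induct)
    case (insert g B)
    then have "g \<in> G" "q g \<in> polys W" using p by auto
    then show ?case using insert by (simp add: add 1)
  qed (simp add: zero)
  then show ?thesis using p by blast
qed

lemma ideal_gen_polys: "G \<subseteq> polys W \<Longrightarrow> ideal_gen W G \<subseteq> polys W"
  by (rule subsetI, erule ideal_gen_induct) (auto intro!: polys_add polys_mult polys_single)

section \<open>Coefficients with respect to a set of variables\<close>

lemma lookup_restrict_mono: "lookup (restrict_mono Y m) y = (if y \<in> Y then lookup m y else 0)"
  by (auto simp: restrict_mono_def lookup_mapp when_def in_keys_iff)

lemma keys_restrict_mono: "keys (restrict_mono Y m) = keys m \<inter> Y"
  by (auto simp: in_keys_iff lookup_restrict_mono split: if_splits)

lemma restrict_mono_add: "restrict_mono Y (u + v) = restrict_mono Y u + restrict_mono Y v"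
  by (rule poly_mapping_eqI) (simp add: lookup_restrict_mono lookup_add)

lemma restrict_mono_split: "restrict_mono Y m + restrict_mono (- Y) m = m"
  by (rule poly_mapping_eqI) (simp add: lookup_restrict_mono lookup_add)

lemma restrict_mono_id: "keys m \<subseteq> Y \<Longrightarrow> restrict_mono Y m = m"
  by (rule poly_mapping_eqI) (auto simp: lookup_restrict_mono in_keys_iff)

lemma restrict_mono_eq_0: "keys m \<inter> Y = {} \<Longrightarrow> restrict_mono Y m = 0"
  by (rule poly_mapping_eqI) (auto simp: lookup_restrict_mono in_keys_iff)

text \<open>Extends \<open>x_coeff\<close> to an arbitrary set of variables. Besides the variables
  in x, the set \<open>- T\<close> is used, to remove from a kernel vector the variables that are
  not parameters.\<close>

definition coeff_at :: "var set \<Rightarrow> mono \<Rightarrow> 'k::comm_ring_1 mpoly \<Rightarrow> 'k mpoly" where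
  "coeff_at Y v p =
     (\<Sum>m\<in>{m \<in> keys p. restrict_mono Y m = v}. single (restrict_mono (- Y) m) (lookup p m))"

lemma x_coeff_eq: "x_coeff p v = coeff_at (range XVar) v p"
  by (simp add: x_coeff_def coeff_at_def xpart_def tpart_def)

text \<open>A monomial splits uniquely into a part in \<open>Y\<close> and a part outside
  \<open>Y\<close>, so no two terms of \<open>p\<close> are merged, and identities between
  coefficients can be checked pointwise.\<close>

lemma lookup_coeff_at:
  "lookup (coeff_at Y v p) u =
     (if keys u \<inter> Y = {} \<and> keys v \<subseteq> Y then lookup p (u + v) else 0)"
proof -
  have *: "restrict_mono Y m = v \<and> restrict_mono (- Y) m = u \<longleftrightarrow>
      keys u \<inter> Y = {} \<and> keys v \<subseteq> Y \<and> m = u + v" (is "?l = ?r") for m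
  proof
    assume ?l
    then have "u = restrict_mono (- Y) m" "v = restrict_mono Y m" by auto
    then show ?r using restrict_mono_split[of Y m]
      by (simp add: keys_restrict_mono add.commute disjoint_eq_subset_Compl)
  next
    assume ?r
    then show ?l by (simp add: restrict_mono_add restrict_mono_id restrict_mono_eq_0
          restrict_mono_id[of u "- Y"] restrict_mono_eq_0[of v "- Y"] disjoint_eq_subset_Compl)
  qed
  have "lookup (coeff_at Y v p) u =
     (\<Sum>m\<in>keys p. if restrict_mono Y m = v \<and> restrict_mono (- Y) m = u then lookup p m else 0)"
    unfolding coeff_at_def
    by (auto simp: sum.inter_filter lookup_sum lookup_single when_def intro!: sum.cong)
  also have "\<dots> = (\<Sum>m\<in>keys p. if m = u + v then
      (if keys u \<inter> Y = {} \<and> keys v \<subseteq> Y then lookup p m else 0) else 0)"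
    by (intro sum.cong refl) (auto simp: *)
  also have "\<dots> = (if keys u \<inter> Y = {} \<and> keys v \<subseteq> Y then lookup p (u + v) else 0)"
    by (simp add: in_keys_iff)
  finally show ?thesis .
qed

lemma coeff_at_zero [simp]: "coeff_at Y v 0 = 0"
  by (simp add: coeff_at_def)

lemma coeff_at_add: "coeff_at Y v (p + q) = coeff_at Y v p + coeff_at Y v q"
  by (rule poly_mapping_eqI) (simp add: lookup_coeff_at lookup_add)

lemma coeff_at_sum: "coeff_at Y v (sum f A) = (\<Sum>i\<in>A. coeff_at Y v (f i))"
  by (induction A rule: infinite_finite_induct) (auto simp: coeff_at_add)

lemma coeff_at_single:
  "coeff_at Y v (single m c) =
     (if restrict_mono Y m = v then single (restrict_mono (- Y) m) c else 0)"
proof (cases "c = 0")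
  case False
  then have "{m' \<in> keys (single m c). restrict_mono Y m' = v} =
      (if restrict_mono Y m = v then {m} else {})" by auto
  then show ?thesis by (auto simp: coeff_at_def)
qed simp

text \<open>A factor free of \<open>Y\<close> leaves the part in \<open>Y\<close> of every monomial
  unchanged; taking a coefficient is therefore linear over such factors.\<close>

lemma coeff_at_mult:
  assumes "c \<in> polys (- Y)"
  shows "coeff_at Y v (c * p) = c * coeff_at Y v p"
proof (induction c rule: terms_induct)
  case (single m a)
  then have m: "restrict_mono Y m = 0" "restrict_mono (- Y) m = m"
    using assms by (auto simp: polys_def monomials_def intro!: restrict_mono_id restrict_mono_eq_0)
  show ?case
    by (induction p rule: terms_induct)
      (auto simp: coeff_at_single mult_single restrict_mono_add m distrib_left coeff_at_add)
qed (auto simp: distrib_right coeff_at_add)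

lemma coeff_at_polys: "p \<in> polys W \<Longrightarrow> coeff_at Y v p \<in> polys (W - Y)"
  unfolding coeff_at_def
  by (intro polys_sum polys_single)
    (auto simp: polys_def monomials_def keys_restrict_mono)

lemma coeff_at_nonzero_ex:
  assumes "p \<noteq> 0"
  shows "\<exists>v. coeff_at Y v p \<noteq> 0"
proof -
  obtain m where m: "lookup p m \<noteq> 0" using assms by (metis lookup_zero poly_mapping_eqI)
  have "lookup (coeff_at Y (restrict_mono Y m) p) (restrict_mono (- Y) m) = lookup p m"
    using restrict_mono_split[of Y m] by (auto simp: lookup_coeff_at keys_restrict_mono add.commute)
  then show ?thesis using m by (metis lookup_zero)
qed

section \<open>Specialization\<close>

definition mono_eval :: "(nat \<times> nat \<Rightarrow> 'k::comm_ring_1) \<Rightarrow> mono \<Rightarrow> 'k" where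
  "mono_eval a m = (\<Prod>y\<in>keys m. case y of TVar j k \<Rightarrow> a (j, k) ^ lookup m y | XVar i \<Rightarrow> 1)"

lemma mono_eval_superset:
  assumes "finite A" "keys m \<subseteq> A"
  shows "mono_eval a m = (\<Prod>y\<in>A. case y of TVar j k \<Rightarrow> a (j, k) ^ lookup m y | XVar i \<Rightarrow> 1)"
  unfolding mono_eval_def
  by (rule prod.mono_neutral_left) (use assms in \<open>auto simp: in_keys_iff split: var.split\<close>)

lemma mono_eval_add: "mono_eval a (u + v) = mono_eval a u * mono_eval a v"
proof -
  let ?A = "keys u \<union> keys v"
  have "mono_eval a u * mono_eval a v = (\<Prod>y\<in>?A.
      (case y of TVar j k \<Rightarrow> a (j, k) ^ lookup u y | XVar i \<Rightarrow> 1) *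
      (case y of TVar j k \<Rightarrow> a (j, k) ^ lookup v y | XVar i \<Rightarrow> 1))"
    by (simp add: mono_eval_superset[of ?A] prod.distrib)
  also have "\<dots> = (\<Prod>y\<in>?A. case y of TVar j k \<Rightarrow> a (j, k) ^ lookup (u + v) y | XVar i \<Rightarrow> 1)"
    by (intro prod.cong) (auto simp: lookup_add power_add split: var.split)
  also have "\<dots> = mono_eval a (u + v)"
    by (rule mono_eval_superset[symmetric]) (auto simp: Poly_Mapping.keys_add)
  finally show ?thesis by simp
qed

lemma mono_eval_x: "keys m \<subseteq> range XVar \<Longrightarrow> mono_eval a m = 1"
  by (auto simp: mono_eval_def intro!: prod.neutral)

lemma mono_eval_tpart: "mono_eval a (tpart m) = mono_eval a m"
proof -
  have "m = xpart m + tpart m" by (simp add: xpart_def tpart_def restrict_mono_split)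
  then have "mono_eval a m = mono_eval a (xpart m) * mono_eval a (tpart m)"
    by (metis mono_eval_add)
  then show ?thesis by (simp add: mono_eval_x xpart_def keys_restrict_mono)
qed

lemma specialize_eq:
  "specialize a p = (\<Sum>m\<in>keys p. single (xpart m) (lookup p m * mono_eval a m))"
  by (simp add: specialize_def mono_eval_def)

lemma specialize_single: "specialize a (single m c) = single (xpart m) (c * mono_eval a m)"
  by (simp add: specialize_eq)

lemma specialize_zero [simp]: "specialize a 0 = 0"
  by (simp add: specialize_eq)

lemma specialize_add: "specialize a (p + q) = specialize a p + specialize a q"
  unfolding specialize_eq
  by (rule setsum_keys_plus_distrib[where f = "\<lambda>m c. single (xpart m) (c * mono_eval a m)"])
    (simp_all add: distrib_right single_add)

lemma specialize_mult: "specialize a (p * q) = specialize a p * specialize a q"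
proof (induction p rule: terms_induct)
  case (single m c)
  show ?case
    by (induction q rule: terms_induct)
      (auto simp: mult_single specialize_single mono_eval_add specialize_add distrib_left
        distrib_right xpart_def restrict_mono_add ac_simps)
qed (auto simp: distrib_right specialize_add)

text \<open>This form allows specialization to be exchanged with determinants.\<close>

lemma comm_ring_hom_specialize: "comm_ring_hom (specialize a)"
proof
  show "specialize a 1 = 1"
    using specialize_single[of a 0 1]
    by (simp add: mono_eval_def xpart_def restrict_mono_eq_0)
qed (auto simp: specialize_add specialize_mult)

text \<open>The bridge between k[t] and k: a coefficient in k[t], evaluated at \<open>a\<close>, is
  the scalar coefficient of the specialized polynomial, embedded as a constant. In particular
  specialization creates no new monomials in x.\<close>

lemma specialize_x_coeff: "specialize a (x_coeff p v) = single 0 (lookup (specialize a p) v)"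
  unfolding x_coeff_eq
proof (induction p rule: terms_induct)
  case (single m c)
  have "xpart (restrict_mono (- range XVar) m) = 0"
    by (simp add: xpart_def restrict_mono_eq_0 keys_restrict_mono)
  then show ?case
    using mono_eval_tpart[of a m]
    by (auto simp: coeff_at_single specialize_single xpart_def tpart_def lookup_single)
qed (auto simp: coeff_at_add specialize_add lookup_add single_add)

lemma specialize_polys:
  assumes "p \<in> polys (T \<union> X)" "X \<subseteq> range XVar" "T \<inter> range XVar = {}"
  shows "specialize a p \<in> polys X"
  unfolding specialize_eq
  by (intro polys_sum polys_single)
    (use assms in \<open>force simp: polys_def monomials_def xpart_def keys_restrict_mono\<close>)

lemma specialize_x_mono:
  assumes "keys m \<subseteq> range XVar"
  shows "specialize a (single m c) = single m c"
  using assms by (simp add: specialize_single mono_eval_x xpart_def restrict_mono_id)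

section \<open>Leading monomials and initial ideals\<close>

lemma linear_order_onD:
  assumes "linear_order_on S r"
  shows "x \<in> S \<Longrightarrow> (x, x) \<in> r" "(x, y) \<in> r \<Longrightarrow> (y, z) \<in> r \<Longrightarrow> (x, z) \<in> r"
    "(x, y) \<in> r \<Longrightarrow> (y, x) \<in> r \<Longrightarrow> x = y" "x \<in> S \<Longrightarrow> y \<in> S \<Longrightarrow> (x, y) \<in> r \<or> (y, x) \<in> r"
    "(x, y) \<in> r \<Longrightarrow> x \<in> S" "(x, y) \<in> r \<Longrightarrow> y \<in> S"
proof -
  show refl: "x \<in> S \<Longrightarrow> (x, x) \<in> r" for x
    using assms by (auto simp: order_on_defs refl_on_def)
  show "(x, y) \<in> r \<Longrightarrow> (y, z) \<in> r \<Longrightarrow> (x, z) \<in> r"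
    using assms by (auto simp: order_on_defs dest: transD)
  show "(x, y) \<in> r \<Longrightarrow> (y, x) \<in> r \<Longrightarrow> x = y"
    using assms by (auto simp: order_on_defs dest: antisymD)
  show "x \<in> S \<Longrightarrow> y \<in> S \<Longrightarrow> (x, y) \<in> r \<or> (y, x) \<in> r"
    using assms refl by (cases "x = y") (auto simp: order_on_defs total_on_def)
  show "(x, y) \<in> r \<Longrightarrow> x \<in> S" "(x, y) \<in> r \<Longrightarrow> y \<in> S"
    using assms by (auto simp: order_on_defs)
qed

lemma linear_order_on_ex_greatest:
  assumes "linear_order_on S r" "finite A" "A \<noteq> {}" "A \<subseteq> S"
  shows "\<exists>m\<in>A. \<forall>m'\<in>A. (m', m) \<in> r"
  using assms(2-4)
proof (induction A rule: finite_ne_induct)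
  case (singleton x)
  then show ?case using linear_order_onD(1)[OF assms(1)] by auto
next
  case (insert x A)
  then obtain m where m: "m \<in> A" "\<forall>m'\<in>A. (m', m) \<in> r" by auto
  show ?case
  proof (cases "(x, m) \<in> r")
    case False
    moreover have "m \<in> S" "x \<in> S" using insert.prems m(1) by auto
    ultimately have "(m, x) \<in> r" "(x, x) \<in> r"
      using linear_order_onD(1,4)[OF assms(1)] by blast+
    then show ?thesis using m linear_order_onD(2)[OF assms(1)] by blast
  qed (use m in auto)
qed

lemma greatest_eqI:
  assumes "linear_order_on S r" "m \<in> A" "\<And>m'. m' \<in> A \<Longrightarrow> (m', m) \<in> r"
  shows "greatest r A = m"
  unfolding Defs.greatest_def
  by (rule the_equality) (use assms linear_order_onD(3)[OF assms(1)] in blast)+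

lemma
  assumes "linear_order_on S r" "finite A" "A \<noteq> {}" "A \<subseteq> S"
  shows greatest_in: "greatest r A \<in> A"
    and greatest_ge: "m \<in> A \<Longrightarrow> (m, greatest r A) \<in> r"
proof -
  obtain m' where m': "m' \<in> A" "\<forall>m\<in>A. (m, m') \<in> r"
    using linear_order_on_ex_greatest[OF assms] by auto
  then have "greatest r A = m'" using greatest_eqI[OF assms(1)] by auto
  then show "greatest r A \<in> A" "m \<in> A \<Longrightarrow> (m, greatest r A) \<in> r" using m' by auto
qed

lemma
  assumes "linear_order_on (monomials W) r" "p \<in> polys W" "p \<noteq> 0"
  shows lead_in_keys: "greatest r (keys p) \<in> keys p"
    and lead_ge: "m \<in> keys p \<Longrightarrow> (m, greatest r (keys p)) \<in> r"
  using greatest_in[OF assms(1), of "keys p"] greatest_ge[OF assms(1), of "keys p"] assms(2,3)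
  by (auto simp: polys_def)

section \<open>Multiplication by a term and leading monomials\<close>

lemma lookup_mult_single: "lookup (single w c * p) (w + m) = c * lookup p m"
  for p :: "'k::comm_ring_1 mpoly"
  by (induction p rule: terms_induct)
    (auto simp: mult_single lookup_single when_def distrib_left lookup_add)

lemma keys_mult_single: "keys (single w c * p) \<subseteq> (+) w ` keys p"
  for p :: "'k::comm_ring_1 mpoly"
  using keys_mult[of "single w c" p] by (auto split: if_splits)

lemma monomial_order_linear: "monomial_order W r \<Longrightarrow> linear_order_on (monomials W) r"
  by (simp add: monomial_order_def well_order_on_def)

lemma monomial_order_add:
  assumes "monomial_order W r" "(u, v) \<in> r" "w \<in> monomials W"
  shows "(w + u, w + v) \<in> r"
  using assms linear_order_onD(5,6)[OF monomial_order_linear[OF assms(1)] assms(2)]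
  by (auto simp: monomial_order_def add.commute)

lemma lead_mult_single:
  fixes p :: "'k::field mpoly"
  assumes "monomial_order W r" "p \<in> polys W" "p \<noteq> 0" "w \<in> monomials W" "c \<noteq> 0"
  shows "greatest r (keys (single w c * p)) = w + greatest r (keys p)"
proof (rule greatest_eqI[OF monomial_order_linear[OF assms(1)]])
  note l = monomial_order_linear[OF assms(1)]
  show "w + greatest r (keys p) \<in> keys (single w c * p)"
    using lead_in_keys[OF l assms(2,3)] assms(5) by (simp add: in_keys_iff lookup_mult_single)
  show "(m', w + greatest r (keys p)) \<in> r" if "m' \<in> keys (single w c * p)" for m'
    using that keys_mult_single[of w c p] lead_ge[OF l assms(2,3)]
      monomial_order_add[OF assms(1)] assms(4) by auto
qed

section \<open>Initial ideals as sets of monomials\<close>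

lemma scale_eq: "scale c p = single 0 c * p"
  by (simp add: scale_def mult_map_scale_conv_mult)

lemma lookup_scale: "lookup (scale c p) m = c * lookup p m"
  using lookup_mult_single[of 0 c p m] by (simp add: scale_eq)

text \<open>The monomials of the initial ideal; the combinatorial part of the proof works with this
  set in place of the ideal.\<close>

definition leads :: "mono rel \<Rightarrow> 'k::comm_ring_1 mpoly set \<Rightarrow> mono set" where
  "leads r I = (\<lambda>f. greatest r (keys f)) ` (I - {0})"

lemma leads_subset:
  assumes "linear_order_on (monomials W) r" "I \<subseteq> polys W"
  shows "leads r I \<subseteq> monomials W"
proof
  fix m assume "m \<in> leads r I"
  then obtain p where "p \<in> I - {0}" "m = greatest r (keys p)"
    unfolding leads_def by blast
  then have p: "p \<in> polys W" "p \<noteq> 0" "m = greatest r (keys p)" using assms(2) by auto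
  then show "m \<in> monomials W" using lead_in_keys[OF assms(1) p(1,2)] by (auto simp: polys_def)
qed

lemma leads_add:
  fixes I :: "'k::field mpoly set"
  assumes "monomial_order W r" "I \<subseteq> polys W" "\<And>c p. p \<in> I \<Longrightarrow> single w c * p \<in> I"
    and "w \<in> monomials W" "m \<in> leads r I"
  shows "w + m \<in> leads r I"
proof -
  obtain p where p: "p \<in> I" "p \<noteq> 0" "m = greatest r (keys p)"
    using assms(5) by (auto simp: leads_def)
  have "greatest r (keys (single w 1 * p)) = w + m"
    using lead_mult_single[OF assms(1), of p w 1] p assms(2,4) by auto
  moreover have "single w 1 * p \<noteq> 0"
    using lookup_mult_single[of w 1 p m] lead_in_keys[OF monomial_order_linear[OF assms(1)], of p]
      p assms(2) by (auto simp: in_keys_iff)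
  ultimately show ?thesis using assms(3)[OF p(1), of 1] unfolding leads_def
    by (intro image_eqI[of _ _ "single w 1 * p"]) auto
qed

lemma keys_span:
  assumes "p \<in> kspan A" "m \<in> keys p"
  shows "\<exists>q\<in>A. m \<in> keys q"
  using assms
proof (induction p rule: kspace.span_induct_alt)
  case (step c x y)
  then show ?case by (cases "lookup x m = 0") (auto simp: in_keys_iff lookup_add lookup_scale)
qed simp

text \<open>Over a field an initial term can be rescaled to any coefficient, so the span is
  determined by the monomials that occur in it.\<close>

lemma initial_ideal_eq:
  fixes I :: "'k::field mpoly set"
  assumes "linear_order_on (monomials W) r" "I \<subseteq> polys W"
  shows "initial_ideal r I = {p. keys p \<subseteq> leads r I}"
proof (intro equalityI subsetI CollectI)
  fix p m assume p: "p \<in> initial_ideal r I" "m \<in> keys p"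
  then obtain f where "f \<in> I" "f \<noteq> 0" "m \<in> keys (init_term r f)"
    unfolding initial_ideal_def using keys_span by blast
  then show "m \<in> leads r I" by (auto simp: init_term_def leads_def split: if_splits)
next
  fix p :: "'k mpoly" assume "p \<in> {p. keys p \<subseteq> leads r I}"
  then have p: "keys p \<subseteq> leads r I" by simp
  show "p \<in> initial_ideal r I"
  proof (induction p rule: terms_induct)
    case (single m c)
    then have "m \<in> leads r I" using p by auto
    then obtain f where "f \<in> I - {0}" and m: "m = greatest r (keys f)"
      unfolding leads_def by blast
    then have f: "f \<in> I" "f \<noteq> 0" "m = greatest r (keys f)" by auto
    then have "lookup f m \<noteq> 0"
      using lead_in_keys[OF assms(1), of f] assms(2) by (auto simp: in_keys_iff)
    then have "single m c = scale (c / lookup f m) (init_term r f)"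
      by (simp add: scale_eq mult_single init_term_def f(3))
    moreover have "init_term r f \<in> kspan (init_term r ` (I - {0}))"
      using f by (intro kspace.span_base) simp
    ultimately show ?case by (simp only: initial_ideal_def kspace.span_scale)
  qed (auto simp: initial_ideal_def kspace.span_zero kspace.span_add)
qed

lemma single_in_initial_ideal:
  fixes I :: "'k::field mpoly set"
  assumes "linear_order_on (monomials W) r" "I \<subseteq> polys W"
  shows "single m 1 \<in> initial_ideal r I \<longleftrightarrow> m \<in> leads r I"
  by (simp add: initial_ideal_eq[OF assms])

lemma keys_ideal_gen:
  assumes "p \<in> ideal_gen W G" "m \<in> keys p"
  shows "\<exists>w\<in>monomials W. \<exists>g\<in>G. \<exists>m'\<in>keys g. m = w + m'"
  using assms
proof (induction p rule: ideal_gen_induct)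
  case (add p q)
  then show ?case using Poly_Mapping.keys_add[of p q] by blast
next
  case (mult w c g)
  then show ?case using keys_mult_single[of w c g] by blast
qed simp

text \<open>Has the same shape as \<open>initial_ideal_eq\<close>, so that equality of a monomial
  ideal with an initial ideal becomes equality of two sets of monomials.\<close>

lemma ideal_gen_monomials:
  "ideal_gen W ((\<lambda>g. single (\<phi> g) (1::'k::field)) ` G) =
    {p. keys p \<subseteq> {w + \<phi> g | w g. w \<in> monomials W \<and> g \<in> G}}" (is "_ = {p. keys p \<subseteq> ?M}")
proof (intro equalityI subsetI CollectI)
  fix p m assume "p \<in> ideal_gen W ((\<lambda>g. single (\<phi> g) (1::'k)) ` G)" "m \<in> keys p"
  from keys_ideal_gen[OF this] show "\<exists>w g. m = w + \<phi> g \<and> w \<in> monomials W \<and> g \<in> G" by auto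
next
  fix p :: "'k mpoly" assume "p \<in> {p. keys p \<subseteq> ?M}"
  then have p: "keys p \<subseteq> ?M" by simp
  show "p \<in> ideal_gen W ((\<lambda>g. single (\<phi> g) 1) ` G)"
  proof (induction p rule: terms_induct)
    case (single m c)
    then obtain w g where "m = w + \<phi> g" "w \<in> monomials W" "g \<in> G" using p by blast
    then have "single m c = single w c * single (\<phi> g) 1" "single w c \<in> polys W"
      "single (\<phi> g) (1::'k) \<in> (\<lambda>g. single (\<phi> g) 1) ` G"
      by (simp_all add: mult_single polys_single)
    then show ?case by (simp only: ideal_gen_gen_mult)
  qed (auto intro: ideal_gen_zero ideal_gen_add)
qed

lemma wf_monomial_order: "monomial_order W r \<Longrightarrow> wf (r - Id)"
  by (simp add: monomial_order_def well_order_on_def)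

text \<open>One element is chosen for each leading monomial. Reduction by these elements terminates
  since the order is well-founded, so they span; their distinct leading monomials make them
  independent.\<close>

lemma dim_eq_card_leads:
  fixes L :: "'k::field mpoly set"
  assumes r: "monomial_order W r" and L: "L \<subseteq> polys W" "kspace.subspace L" and fin: "finite (leads r L)"
  shows "kdim L = card (leads r L)"
proof -
  note l = monomial_order_linear[OF r]
  note lD = linear_order_onD[OF l]
  have "\<exists>f. f \<in> L \<and> f \<noteq> 0 \<and> greatest r (keys f) = m" if "m \<in> leads r L" for m
    using that by (auto simp: leads_def)
  then obtain f where f: "\<And>m. m \<in> leads r L \<Longrightarrow> f m \<in> L \<and> f m \<noteq> 0 \<and> greatest r (keys (f m)) = m"
    by metis
  have f_lead: "lookup (f m) m \<noteq> 0" if "m \<in> leads r L" for m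
    using lead_in_keys[OF l, of "f m"] f[OF that] L by (auto simp: in_keys_iff)
  have f_gt: "lookup (f m) m' = 0" if "m \<in> leads r L" "(m, m') \<in> r" "m \<noteq> m'" for m m'
    using lead_ge[OF l, of "f m" m'] f[OF that(1)] L lD(3) that(2,3)
    by (auto simp: in_keys_iff)
  have inj: "inj_on f (leads r L)" by (rule inj_onI) (metis f)
  have "L \<subseteq> kspan (f ` leads r L)"
  proof
    fix p assume "p \<in> L"
    then show "p \<in> kspan (f ` leads r L)"
    proof (induction "greatest r (keys p)" arbitrary: p rule: wf_induct_rule[OF wf_monomial_order[OF r]])
      case (1 p)
      show ?case
      proof (cases "p = 0")
        case False
        define m where "m = greatest r (keys p)"
        have m: "m \<in> leads r L" using 1 False by (auto simp: leads_def m_def)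
        define q where "q = p - scale (lookup p m / lookup (f m) m) (f m)"
        have qL: "q \<in> L" unfolding q_def
          using 1 f[OF m] L(2) by (simp add: kspace.subspace_diff kspace.subspace_scale)
        have q_lt: "(m', m) \<in> r \<and> m' \<noteq> m" if "m' \<in> keys q" for m'
        proof -
          have "m' \<noteq> m" using that f_lead[OF m]
            by (auto simp: in_keys_iff q_def lookup_minus lookup_scale)
          moreover have "m' \<in> keys p \<or> m' \<in> keys (f m)"
            using that by (auto simp: in_keys_iff q_def lookup_minus lookup_scale)
          then have "(m', m) \<in> r"
            using lead_ge[OF l, of p m'] lead_ge[OF l, of "f m" m'] f[OF m] 1 L False
            by (auto simp: m_def)
          ultimately show ?thesis by simp
        qed
        have "q \<in> kspan (f ` leads r L)"
        proof (cases "q = 0")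
          case qn: False
          then have "(greatest r (keys q), m) \<in> r - Id"
            using q_lt lead_in_keys[OF l, of q] qL L by auto
          then show ?thesis using 1(1) qL by (simp add: m_def)
        qed (simp add: kspace.span_zero)
        moreover have "p = q + scale (lookup p m / lookup (f m) m) (f m)" by (simp add: q_def)
        ultimately show ?thesis using m
          by (metis imageI kspace.span_add kspace.span_base kspace.span_scale)
      qed (simp add: kspace.span_zero)
    qed
  qed
  moreover have "f ` leads r L \<subseteq> L" using f by auto
  moreover have "kspace.independent (f ` leads r L)"
  proof (rule kspace.independent_if_scalars_zero)
    show "finite (f ` leads r L)" using fin by simp
    fix c x assume sum0: "(\<Sum>x\<in>f ` leads r L. scale (c x) x) = 0" and x: "x \<in> f ` leads r L"
    have s: "(\<Sum>m\<in>leads r L. c (f m) * lookup (f m) u) = 0" for u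
      using arg_cong[OF sum0, of "\<lambda>p. lookup p u"]
      by (simp add: sum.reindex[OF inj] lookup_sum lookup_scale)
    have "{m \<in> leads r L. c (f m) \<noteq> 0} = {}" (is "?A = {}")
    proof (rule ccontr)
      assume ne: "?A \<noteq> {}"
      have sub: "?A \<subseteq> monomials W" using leads_subset[OF l L(1)] by auto
      \<comment> \<open>Among the elements with nonzero scalar, the one with the greatest leading
        monomial \<open>u\<close> is the only one that contributes to the coefficient at
        \<open>u\<close>.\<close>
      define u where "u = greatest r ?A"
      have u: "u \<in> ?A" "\<And>m. m \<in> ?A \<Longrightarrow> (m, u) \<in> r"
        unfolding u_def using greatest_in[OF l _ ne sub] greatest_ge[OF l _ ne sub] fin by auto
      have "c (f m) * lookup (f m) u = 0" if "m \<in> leads r L - {u}" for m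
        using that u(2)[of m] f_gt[of m u] by auto
      then have "(\<Sum>m\<in>leads r L - {u}. c (f m) * lookup (f m) u) = 0" by (rule sum.neutral[OF ballI])
      moreover have "(\<Sum>m\<in>leads r L. c (f m) * lookup (f m) u) =
          c (f u) * lookup (f u) u + (\<Sum>m\<in>leads r L - {u}. c (f m) * lookup (f m) u)"
        by (rule sum.remove) (use u(1) fin in auto)
      ultimately have "c (f u) * lookup (f u) u = 0" using s[of u] by simp
      then show False using u(1) f_lead[of u] by simp
    qed
    then show "c x = 0" using x by auto
  qed
  ultimately have "card (f ` leads r L) = kdim L" by (intro kspace.basis_card_eq_dim)
  then show ?thesis using card_image[OF inj] by simp
qed

section \<open>Homogeneous components\<close>

text \<open>The grading counts only the variables in x, the parameters having degree zero. It thus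
  serves the ideal in k[t,x] and, as the usual grading, the specialized ideals.\<close>

definition x_comp :: "nat \<Rightarrow> 'k::comm_ring_1 mpoly \<Rightarrow> 'k mpoly" where
  "x_comp D p = (\<Sum>m\<in>{m \<in> keys p. mdeg (xpart m) = D}. single m (lookup p m))"

lemma lookup_x_comp: "lookup (x_comp D p) m = (if mdeg (xpart m) = D then lookup p m else 0)"
  unfolding x_comp_def
  by (auto simp: lookup_sum lookup_single when_def in_keys_iff)

lemma x_comp_add: "x_comp D (p + q) = x_comp D p + x_comp D q"
  by (rule poly_mapping_eqI) (simp add: lookup_x_comp lookup_add)

lemma x_comp_zero [simp]: "x_comp D 0 = 0"
  by (simp add: x_comp_def)

lemma x_comp_homogeneous:
  assumes "\<And>m. m \<in> keys p \<Longrightarrow> mdeg (xpart m) = d"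
  shows "x_comp D p = (if d = D then p else 0)"
  by (rule poly_mapping_eqI) (use assms in \<open>auto simp: lookup_x_comp in_keys_iff\<close>)

lemma mdeg_superset:
  assumes "finite A" "keys m \<subseteq> A"
  shows "mdeg m = (\<Sum>y\<in>A. lookup m y)"
  unfolding mdeg_def by (rule sum.mono_neutral_left) (use assms in \<open>auto simp: in_keys_iff\<close>)

lemma mdeg_add: "mdeg (u + v) = mdeg u + mdeg v"
proof -
  have "mdeg (u + v) = (\<Sum>y\<in>keys u \<union> keys v. lookup (u + v) y)"
    by (rule mdeg_superset) (auto simp: Poly_Mapping.keys_add)
  also have "\<dots> = mdeg u + mdeg v"
    by (simp add: lookup_add sum.distrib mdeg_superset[of "keys u \<union> keys v"])
  finally show ?thesis .
qed

lemma xpart_add: "xpart (u + v) = xpart u + xpart v"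
  by (simp add: xpart_def restrict_mono_add)

lemma xpart_id: "keys m \<subseteq> range XVar \<Longrightarrow> xpart m = m"
  by (simp add: xpart_def restrict_mono_id)

lemma xpart_x_coeff: "x_coeff p v \<noteq> 0 \<Longrightarrow> xpart v = v"
  by (metis x_coeff_eq lookup_coeff_at poly_mapping_eqI lookup_zero xpart_id)

text \<open>A multiple of a homogeneous generator by one term is homogeneous, so taking a component
  either keeps it or kills it.\<close>

lemma ideal_gen_x_comp:
  assumes "p \<in> ideal_gen W G"
    and homog: "\<And>g. g \<in> G \<Longrightarrow> \<exists>d. \<forall>m\<in>keys g. mdeg (xpart m) = d"
  shows "x_comp D p \<in> ideal_gen W G"
  using assms(1)
proof (induction p rule: ideal_gen_induct)
  case (mult w c g)
  obtain d where d: "\<And>m. m \<in> keys g \<Longrightarrow> mdeg (xpart m) = d" using homog[OF mult(2)] by blast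
  have "mdeg (xpart m) = mdeg (xpart w) + d" if "m \<in> keys (single w c * g)" for m
    using that keys_mult_single[of w c g] d by (auto simp: xpart_add mdeg_add)
  then have "x_comp D (single w c * g) = (if mdeg (xpart w) + d = D then single w c * g else 0)"
    by (rule x_comp_homogeneous)
  then show ?case
    using mult by (auto intro: ideal_gen_zero ideal_gen_gen_mult polys_single)
qed (auto simp: x_comp_add intro: ideal_gen_zero ideal_gen_add)

lemma x_coeff_x_comp: "x_coeff (x_comp D p) v = (if mdeg v = D then x_coeff p v else 0)"
proof (rule poly_mapping_eqI)
  fix u
  have "xpart (u + v) = v" if "keys u \<inter> range XVar = {}" "keys v \<subseteq> range XVar"
    using that by (simp add: xpart_def restrict_mono_add restrict_mono_id restrict_mono_eq_0)
  then show "lookup (x_coeff (x_comp D p) v) u = lookup (if mdeg v = D then x_coeff p v else 0) u"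
    by (auto simp: x_coeff_eq lookup_coeff_at lookup_x_comp)
qed

section \<open>Graded pieces\<close>

lemma finite_monomials_deg:
  assumes "finite W"
  shows "finite (monomials_deg W D)"
proof (rule finite_subset)
  let ?F = "{f. \<forall>y. (y \<in> W \<longrightarrow> f y \<in> {0..D}) \<and> (y \<notin> W \<longrightarrow> f y = (0::nat))}"
  show "finite (lookup -` ?F)"
    by (intro finite_vimageI finite_set_of_finite_funs assms) (auto intro: injI poly_mapping_eqI)
  show "monomials_deg W D \<subseteq> lookup -` ?F"
  proof
    fix m assume m: "m \<in> monomials_deg W D"
    have "lookup m y \<le> D" for y
    proof (cases "y \<in> keys m")
      case True
      then have "lookup m y \<le> mdeg m" unfolding mdeg_def by (intro member_le_sum) auto
      then show ?thesis using m by (simp add: monomials_deg_def)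
    qed (simp add: in_keys_iff)
    then show "m \<in> lookup -` ?F"
      using m by (auto simp: monomials_deg_def monomials_def in_keys_iff)
  qed
qed

lemma subspace_ideal_gen: "kspace.subspace (ideal_gen W (G :: 'k::field mpoly set))"
  by (rule kspace.subspaceI)
    (simp_all add: scale_eq ideal_gen_zero ideal_gen_add ideal_gen_mult polys_single)

lemma subspace_homog: "kspace.subspace (homog W D :: 'k::field mpoly set)"
proof (rule kspace.subspaceI)
  fix p q :: "'k mpoly" and c
  assume p: "p \<in> homog W D"
  show "scale c p \<in> homog W D" using p by (auto simp: homog_def in_keys_iff lookup_scale)
  assume "q \<in> homog W D"
  then show "p + q \<in> homog W D" using p Poly_Mapping.keys_add[of p q] by (auto simp: homog_def)
qed (simp add: homog_def)

text \<open>If \<open>m\<close> is the leading monomial of \<open>p\<close>, it is still the leading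
  monomial of the component of \<open>p\<close> in the degree of \<open>m\<close>.\<close>

lemma leads_homogeneous:
  fixes I :: "'k::field mpoly set"
  assumes r: "linear_order_on (monomials X) r" and X: "X \<subseteq> range XVar"
    and I: "I \<subseteq> polys X" "\<And>p. p \<in> I \<Longrightarrow> x_comp D p \<in> I"
  shows "leads r (I \<inter> homog X D) = leads r I \<inter> monomials_deg X D"
proof (intro equalityI subsetI)
  fix m assume "m \<in> leads r (I \<inter> homog X D)"
  then obtain p where "p \<in> I \<inter> homog X D - {0}" and m: "m = greatest r (keys p)"
    unfolding leads_def by blast
  then have p: "p \<in> I" "p \<in> homog X D" "p \<noteq> 0" by auto
  then have "m \<in> keys p" unfolding m using I(1) by (intro lead_in_keys[OF r]) auto
  then have "m \<in> monomials_deg X D" using p(2) by (auto simp: homog_def)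
  moreover have "m \<in> leads r I" using p(1,3) by (auto simp: m leads_def)
  ultimately show "m \<in> leads r I \<inter> monomials_deg X D" by simp
next
  fix m assume *: "m \<in> leads r I \<inter> monomials_deg X D"
  then obtain p where "p \<in> I - {0}" and m: "m = greatest r (keys p)"
    unfolding leads_def by blast
  then have p: "p \<in> I" "p \<noteq> 0" by auto
  then have pX: "p \<in> polys X" using I(1) by auto
  have xm: "xpart u = u" if "u \<in> monomials X" for u
    using that X by (intro xpart_id) (auto simp: monomials_def)
  define q where "q = x_comp D p"
  have "xpart m = m" "mdeg m = D" using * xm by (auto simp: monomials_deg_def)
  then have mq: "m \<in> keys q"
    using lead_in_keys[OF r pX p(2)] by (simp add: q_def in_keys_iff lookup_x_comp m)
  have kq: "u \<in> keys p \<and> mdeg (xpart u) = D" if "u \<in> keys q" for u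
    using that by (auto simp: q_def in_keys_iff lookup_x_comp split: if_splits)
  have "greatest r (keys q) = m"
    using mq kq lead_ge[OF r pX p(2)] by (intro greatest_eqI[OF r]) (auto simp: m)
  moreover have "q \<in> homog X D"
  proof -
    have "u \<in> monomials_deg X D" if "u \<in> keys q" for u
      using kq[OF that] pX xm[of u] by (auto simp: polys_def monomials_deg_def)
    then show ?thesis by (auto simp: homog_def)
  qed
  moreover have "q \<in> I" using I(2) p(1) by (simp add: q_def)
  moreover have "q \<noteq> 0" using mq by auto
  ultimately show "m \<in> leads r (I \<inter> homog X D)" unfolding leads_def by blast
qed

section \<open>Polynomials over an infinite field\<close>

text \<open>The induction generalizes from monomials to exponent functions that are pairwise distinct on \<open>W\<close>:
  fixing the exponent of one variable keeps them distinct on the remaining ones.\<close>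

lemma coeffs_zero_if_fun_zero:
  fixes c :: "'i \<Rightarrow> 'k::field" and E :: "'i \<Rightarrow> 'v \<Rightarrow> nat"
  assumes "infinite (UNIV :: 'k set)" "finite W" "finite S"
    and "\<And>i i'. i \<in> S \<Longrightarrow> i' \<in> S \<Longrightarrow> (\<And>y. y \<in> W \<Longrightarrow> E i y = E i' y) \<Longrightarrow> i = i'"
    and "\<And>a. (\<Sum>i\<in>S. c i * (\<Prod>y\<in>W. a y ^ E i y)) = 0"
    and "i \<in> S"
  shows "c i = 0"
  using assms(2-6)
proof (induction W arbitrary: S i rule: finite_induct)
  case empty
  have "S = {i}" using empty.prems(2,4) by auto
  then show ?case using empty.prems(3)[of undefined] by simp
next
  case (insert x W)
  define S' where "S' = {i' \<in> S. E i' x = E i x}"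
  have fS: "finite S" by fact
  have "(\<Sum>i\<in>S'. c i * (\<Prod>y\<in>W. a y ^ E i y)) = 0" for a
  proof -
    define f where "f = (\<lambda>i. c i * (\<Prod>y\<in>W. a y ^ E i y))"
    \<comment> \<open>With the other values fixed, the sum is a univariate polynomial in the value
      \<open>z\<close> of \<open>x\<close>. It vanishes on an infinite field, so its coefficient at
      \<open>E i x\<close>, which is the sum over \<open>S'\<close>, is zero.\<close>
    define p where "p = (\<Sum>i\<in>S. Polynomial.monom (f i) (E i x))"
    have "poly p z = 0" for z
    proof -
      have "(\<Prod>y\<in>insert x W. (a(x := z)) y ^ E i y) = z ^ E i x * (\<Prod>y\<in>W. a y ^ E i y)" for i
      proof -
        have "(\<Prod>y\<in>W. (a(x := z)) y ^ E i y) = (\<Prod>y\<in>W. a y ^ E i y)"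
          by (rule prod.cong) (use insert.hyps in auto)
        then show ?thesis using insert.hyps by simp
      qed
      then show ?thesis using insert.prems(3)[of "a(x := z)"]
        by (simp add: p_def f_def poly_sum poly_monom ac_simps)
    qed
    then have "p = 0" using assms(1) poly_roots_finite[of p] by auto
    then have "coeff p (E i x) = 0" by simp
    then have "(\<Sum>i'\<in>S. if E i' x = E i x then f i' else 0) = 0"
      by (simp add: p_def coeff_sum)
    then have "(\<Sum>i'\<in>S'. f i') = 0" using fS by (simp only: S'_def sum.inter_filter)
    then show ?thesis by (simp add: f_def)
  qed
  moreover have "i' = i''"
    if "i' \<in> S'" "i'' \<in> S'" "\<And>y. y \<in> W \<Longrightarrow> E i' y = E i'' y" for i' i''
    using that by (intro insert.prems(2)) (auto simp: S'_def)
  ultimately show ?case using fS insert.prems(4) by (intro insert.IH[of S']) (auto simp: S'_def)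
qed

lemma specialize_nonzero_ex:
  fixes p :: "'k::field mpoly"
  assumes "infinite (UNIV :: 'k set)" "finite P" "p \<in> polys ((\<lambda>(j, k). TVar j k) ` P)" "p \<noteq> 0"
  shows "\<exists>a\<in>P \<rightarrow>\<^sub>E UNIV. specialize a p \<noteq> 0"
proof (rule ccontr)
  assume "\<not> ?thesis"
  then have z: "specialize a p = 0" if "a \<in> P \<rightarrow>\<^sub>E UNIV" for a using that by blast
  have keysp: "keys m \<subseteq> (\<lambda>(j, k). TVar j k) ` P" if "m \<in> keys p" for m
    using that assms(3) by (auto simp: polys_def monomials_def)
  define E :: "mono \<Rightarrow> nat \<times> nat \<Rightarrow> nat" where "E = (\<lambda>m (j, k). lookup m (TVar j k))"
  have ev: "mono_eval a m = (\<Prod>y\<in>P. a y ^ E m y)" if "m \<in> keys p" for a :: "nat \<times> nat \<Rightarrow> 'k" and m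
  proof -
    have "inj_on (\<lambda>(j, k). TVar j k) P" by (auto simp: inj_on_def)
    then have "mono_eval a m = (\<Prod>z\<in>P. case (case z of (j, k) \<Rightarrow> TVar j k) of
        TVar j k \<Rightarrow> a (j, k) ^ lookup m (case z of (j, k) \<Rightarrow> TVar j k) | XVar i \<Rightarrow> 1)"
      by (simp add: mono_eval_superset[OF _ keysp[OF that]] assms(2) prod.reindex comp_def)
    also have "\<dots> = (\<Prod>y\<in>P. a y ^ E m y)"
      by (intro prod.cong) (auto simp: E_def)
    finally show ?thesis .
  qed
  have xp: "xpart m = 0" if "m \<in> keys p" for m
    unfolding xpart_def by (rule restrict_mono_eq_0) (use keysp[OF that] in auto)
  have "keys p \<noteq> {}" using assms(4) by simp
  then obtain m where m: "m \<in> keys p" by blast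
  have "lookup p m = 0"
  proof (rule coeffs_zero_if_fun_zero[OF assms(1,2) finite_keys _ _ m])
    fix u v assume uv: "u \<in> keys p" "v \<in> keys p" "\<And>y. y \<in> P \<Longrightarrow> E u y = E v y"
    show "u = v"
    proof (rule poly_mapping_eqI)
      fix y
      show "lookup u y = lookup v y"
      proof (cases "y \<in> (\<lambda>(j, k). TVar j k) ` P")
        case True
        then show ?thesis using uv(3) by (auto simp: E_def)
      next
        case False
        then have "y \<notin> keys u" "y \<notin> keys v" using keysp uv(1,2) by blast+
        then show ?thesis by (simp add: in_keys_iff)
      qed
    qed
  next
    fix a :: "nat \<times> nat \<Rightarrow> 'k"
    \<comment> \<open>Points of the parameter space are undefined outside \<open>P\<close>;
      restricting \<open>a\<close> makes it a point without changing the values on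
      \<open>P\<close>.\<close>
    define b where "b = restrict a P"
    have "0 = lookup (specialize b p) 0" using z[of b] by (simp add: b_def)
    also have "\<dots> = (\<Sum>m\<in>keys p. lookup p m * mono_eval b m)"
      by (simp add: specialize_eq lookup_sum xp)
    also have "\<dots> = (\<Sum>m\<in>keys p. lookup p m * (\<Prod>y\<in>P. a y ^ E m y))"
      by (intro sum.cong refl) (simp add: ev b_def)
    finally show "(\<Sum>m\<in>keys p. lookup p m * (\<Prod>y\<in>P. a y ^ E m y)) = 0" by simp
  qed
  then show False using m by (simp add: in_keys_iff)
qed

section \<open>Decreasing lists of monomials\<close>

abbreviation decreasing :: "mono rel \<Rightarrow> mono list \<Rightarrow> bool" where
  "decreasing r \<equiv> sorted_wrt (\<lambda>u v. (v, u) \<in> r \<and> u \<noteq> v)"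

lemma decreasing_distinct:
  assumes "linear_order_on S r" "decreasing r xs"
  shows "distinct xs"
  using assms(2) by (induction xs) auto

lemma ex_decreasing:
  assumes "linear_order_on S r" "finite A" "A \<subseteq> S"
  shows "\<exists>xs. set xs = A \<and> decreasing r xs"
  using assms(2,3)
proof (induction "card A" arbitrary: A)
  case (Suc k)
  then have "A \<noteq> {}" by auto
  then obtain m where m: "m \<in> A" "\<forall>m'\<in>A. (m', m) \<in> r"
    using linear_order_on_ex_greatest[OF assms(1) Suc.prems(1) _ Suc.prems(2)] by blast
  have "k = card (A - {m})" using Suc m by simp
  then obtain xs where "set xs = A - {m}" "decreasing r xs"
    using Suc.hyps(1)[of "A - {m}"] Suc.prems by auto
  then show ?case using m by (intro exI[of _ "m # xs"]) auto
qed auto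

text \<open>At the first index \<open>i\<close> of disagreement, the entries 0 to \<open>i\<close>
  of \<open>ms'\<close> all lie at or above \<open>ms' ! i\<close>. If \<open>ms' ! i\<close> were
  above \<open>ms ! i\<close>, at most the first \<open>i\<close> entries of \<open>ms\<close> would
  do so, against the count for \<open>ms' ! i\<close>.\<close>

lemma ext_ge_if_counts:
  assumes lin: "linear_order_on S r" and len: "length ms = length ms'"
    and dec: "decreasing r ms" "decreasing r ms'" and sub: "set ms \<subseteq> S" "set ms' \<subseteq> S"
    and counts: "\<And>m. m \<in> S \<Longrightarrow> card {u \<in> set ms'. (m, u) \<in> r} \<le> card {u \<in> set ms. (m, u) \<in> r}"
  shows "ext_ge r ms ms'"
proof (cases "ms = ms'")
  case False
  note lD = linear_order_onD[OF lin]
  define i where "i = (LEAST i. i < length ms \<and> ms ! i \<noteq> ms' ! i)"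
  have "\<exists>i. i < length ms \<and> ms ! i \<noteq> ms' ! i" using False len by (auto simp: list_eq_iff_nth_eq)
  from LeastI_ex[OF this] have i: "i < length ms" "ms ! i \<noteq> ms' ! i" by (auto simp: i_def)
  have same: "ms ! l = ms' ! l" if "l < i" for l
    using that not_less_Least[of l "\<lambda>i. i < length ms \<and> ms ! i \<noteq> ms' ! i"] i(1) by (auto simp: i_def)
  have mem: "ms ! i \<in> S" "ms' ! i \<in> S" using i len sub by auto
  have "(ms' ! i, ms ! i) \<in> r"
  proof (rule ccontr)
    assume n: "(ms' ! i, ms ! i) \<notin> r"
    have "{u \<in> set ms. (ms' ! i, u) \<in> r} \<subseteq> (!) ms ` {..<i}"
    proof
      fix u assume u: "u \<in> {u \<in> set ms. (ms' ! i, u) \<in> r}"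
      then obtain l where l: "l < length ms" "u = ms ! l" by (auto simp: in_set_conv_nth)
      have "l < i"
      proof (rule ccontr)
        assume "\<not> l < i"
        then have "l = i \<or> (ms ! l, ms ! i) \<in> r"
          using dec(1) l by (auto simp: sorted_wrt_iff_nth_less not_less le_less)
        then show False using u n l lD(2) by auto
      qed
      then show "u \<in> (!) ms ` {..<i}" using l by auto
    qed
    then have "card {u \<in> set ms. (ms' ! i, u) \<in> r} \<le> card ((!) ms ` {..<i})"
      by (intro card_mono) auto
    also have "\<dots> \<le> i" using card_image_le[of "{..<i}" "(!) ms"] by simp
    finally have "card {u \<in> set ms. (ms' ! i, u) \<in> r} \<le> i" .
    moreover have "(!) ms' ` {..i} \<subseteq> {u \<in> set ms'. (ms' ! i, u) \<in> r}"
      using dec(2) i len lD(1)[OF mem(2)] by (auto simp: sorted_wrt_iff_nth_less le_less)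
    then have "card ((!) ms' ` {..i}) \<le> card {u \<in> set ms'. (ms' ! i, u) \<in> r}"
      by (intro card_mono) auto
    moreover have "inj_on ((!) ms') {..i}"
      using decreasing_distinct[OF lin dec(2)] i len by (auto intro!: inj_onI simp: nth_eq_iff_index_eq)
    then have "card ((!) ms' ` {..i}) = Suc i" by (simp add: card_image)
    ultimately show False using counts[OF mem(2)] by simp
  qed
  then show ?thesis using i same by (auto simp: ext_ge_def)
qed (simp add: ext_ge_def)

lemma ext_ge_antisym:
  assumes lin: "linear_order_on S r" and "ext_ge r ms ms'" "ext_ge r ms' ms"
  shows "ms = ms'"
proof (rule ccontr)
  assume "ms \<noteq> ms'"
  then obtain i j where
    "\<forall>l<i. ms ! l = ms' ! l" "ms ! i \<noteq> ms' ! i" "(ms' ! i, ms ! i) \<in> r"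
    "\<forall>l<j. ms' ! l = ms ! l" "ms' ! j \<noteq> ms ! j" "(ms ! j, ms' ! j) \<in> r"
    using assms(2,3) by (auto simp: ext_ge_def)
  then show False using linear_order_onD(3)[OF lin] by (metis linorder_neqE_nat)
qed

text \<open>Equal sets have equal counts, so the lexicographic comparison holds in both
  directions.\<close>

lemma decreasing_unique:
  assumes "linear_order_on S r" "decreasing r ms" "decreasing r ms'" "set ms = set ms'" "set ms \<subseteq> S"
  shows "ms = ms'"
proof -
  have "length ms = length ms'"
    using distinct_card[OF decreasing_distinct[OF assms(1,2)]]
      distinct_card[OF decreasing_distinct[OF assms(1,3)]] assms(4) by simp
  then show ?thesis using assms
    by (intro ext_ge_antisym[OF assms(1)] ext_ge_if_counts[OF assms(1)]) auto
qed

section \<open>Families of ideals with a dominating set of leading monomials\<close>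

text \<open>\<open>M\<close> enters only through an upper bound for the counts at every point and
  one point \<open>a0\<close> that reaches it. The maximal dimension and the maximal exterior
  monomial are therefore attained at \<open>a0\<close>.\<close>

lemma V_set_eq:
  fixes I :: "'p \<Rightarrow> 'k::field mpoly set"
  assumes r: "monomial_order (xvars n) r"
    and I: "\<And>a. a \<in> P \<Longrightarrow> I a \<subseteq> polys (xvars n)" "\<And>a. a \<in> P \<Longrightarrow> kspace.subspace (I a)"
      "\<And>a p D. a \<in> P \<Longrightarrow> p \<in> I a \<Longrightarrow> x_comp D p \<in> I a"
    and counts: "\<And>a D m. a \<in> P \<Longrightarrow> m \<in> monomials (xvars n) \<Longrightarrow>
      card {u \<in> leads r (I a) \<inter> monomials_deg (xvars n) D. (m, u) \<in> r} \<le>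
      card {u \<in> M \<inter> monomials_deg (xvars n) D. (m, u) \<in> r}"
    and a0: "a0 \<in> P" "M \<subseteq> leads r (I a0)"
  shows "V_set n r P I =
    {a \<in> P. \<forall>D. leads r (I a) \<inter> monomials_deg (xvars n) D = M \<inter> monomials_deg (xvars n) D}"
    and "a0 \<in> V_set n r P I"
proof -
  note lin = monomial_order_linear[OF r]
  note lD = linear_order_onD[OF lin]
  define L where "L = (\<lambda>D a. leads r (I a) \<inter> monomials_deg (xvars n) D)"
  define K where "K = (\<lambda>D. M \<inter> monomials_deg (xvars n) D)"
  have sub: "L D a \<subseteq> monomials (xvars n)" "K D \<subseteq> monomials (xvars n)" for D a
    by (auto simp: L_def K_def monomials_deg_def)
  have fin: "finite (L D a)" "finite (K D)" for D a
    using finite_monomials_deg[of "xvars n" D] by (auto simp: L_def K_def xvars_def)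
  have card_le: "card (L D a) \<le> card (K D)" if "a \<in> P" for D a
  proof (cases "L D a = {}")
    case False
    \<comment> \<open>The least element is obtained as the greatest one for the converse
      order.\<close>
    then have "\<exists>m\<in>L D a. \<forall>m'\<in>L D a. (m, m') \<in> r"
      using linear_order_on_ex_greatest[of _ "r\<inverse>", OF _ fin(1) _ sub(1)] lin by auto
    then obtain m where m: "m \<in> L D a" "\<And>m'. m' \<in> L D a \<Longrightarrow> (m, m') \<in> r" by blast
    have "card (L D a) = card {u \<in> L D a. (m, u) \<in> r}"
      using m by (intro arg_cong[of _ _ card]) auto
    also have "\<dots> \<le> card {u \<in> K D. (m, u) \<in> r}"
      using counts[OF that, of m D] m sub by (auto simp: L_def K_def)
    also have "\<dots> \<le> card (K D)" by (intro card_mono fin) auto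
    finally show ?thesis .
  qed simp
  \<comment> \<open>One inclusion is given at \<open>a0\<close>, and the bound on cardinalities
    turns it into an equality.\<close>
  have L_a0: "L D a0 = K D" for D
    using card_seteq[OF fin(1), of "K D" D a0] card_le[OF a0(1)] a0(2) by (auto simp: L_def K_def)
  have dim: "kdim (I a \<inter> homog (xvars n) D) = card (L D a)" if "a \<in> P" for a D
  proof -
    have "leads r (I a \<inter> homog (xvars n) D) = L D a"
      unfolding L_def using I[OF that]
      by (intro leads_homogeneous[OF lin]) (auto simp: xvars_def)
    moreover have "kspace.subspace (I a \<inter> homog (xvars n) D)"
      using I(2)[OF that] subspace_homog by (rule kspace.subspace_inter)
    ultimately show ?thesis
      using dim_eq_card_leads[OF r, of "I a \<inter> homog (xvars n) D"] I(1)[OF that] fin by auto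
  qed
  have max_dim: "max_dim n P I D = card (K D)" for D
    unfolding max_dim_def
  proof (rule Max_eqI)
    \<comment> \<open>The set of points may be infinite, but the dimensions are bounded, so
      \<open>Max\<close> is a genuine maximum.\<close>
    show "finite ((\<lambda>a. kdim (I a \<inter> homog (xvars n) D)) ` P)"
      by (rule finite_subset[of _ "{..card (K D)}"]) (auto simp: dim card_le)
    show "card (K D) \<in> (\<lambda>a. kdim (I a \<inter> homog (xvars n) D)) ` P"
      using a0(1) dim[OF a0(1), of D] by (auto simp: L_a0 intro!: image_eqI[of _ _ a0])
  qed (auto simp: dim card_le)
  then have U: "U_deg n P I D = {a \<in> P. card (L D a) = card (K D)}" for D
    by (auto simp: U_deg_def dim)
  \<comment> \<open>Each finite set of monomials has exactly one decreasing list, so exterior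
    monomials can be identified with sets.\<close>
  define dl where "dl = (\<lambda>A. THE ms. set ms = A \<and> decreasing r ms)"
  have dl: "set (dl A) = A \<and> decreasing r (dl A)"
    and dl_eqI: "\<And>ms. set ms = A \<Longrightarrow> decreasing r ms \<Longrightarrow> ms = dl A"
    if A: "finite A" "A \<subseteq> monomials (xvars n)" for A
  proof -
    have ex: "\<exists>!ms. set ms = A \<and> decreasing r ms"
      using ex_decreasing[OF lin A] decreasing_unique[OF lin] A by blast
    from theI'[OF ex] show *: "set (dl A) = A \<and> decreasing r (dl A)" unfolding dl_def .
    show "ms = dl A" if "set ms = A" "decreasing r ms" for ms using ex * that by blast
  qed
  have dl_length: "length (dl A) = card A" if "finite A" "A \<subseteq> monomials (xvars n)" for A
    using dl[OF that] distinct_card[OF decreasing_distinct[OF lin, of "dl A"]] by simp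
  have init_ext: "init_ext_mono n r P I D a = dl (L D a)" if "a \<in> U_deg n P I D" for D a
  proof -
    have aP: "a \<in> P" using that by (simp add: U)
    have "{m \<in> monomials_deg (xvars n) D. single m 1 \<in> initial_ideal r (I a)} = L D a"
      by (auto simp: single_in_initial_ideal[OF lin I(1)[OF aP]] L_def)
    then show ?thesis
      unfolding init_ext_mono_def max_dim
      using that dl[OF fin(1) sub(1), of D a] dl_length[OF fin(1) sub(1), of D a]
        dl_eqI[OF fin(1) sub(1), of _ D a]
      by (intro the_equality) (auto simp: std_ext_monomials_def U L_def)
  qed
  have ge: "ext_ge r (dl (K D)) (dl (L D a))" if "a \<in> U_deg n P I D" for D a
    using that dl[OF fin(1) sub(1), of D a] dl[OF fin(2) sub(2), of D] sub
      dl_length[OF fin(1) sub(1), of D a] dl_length[OF fin(2) sub(2), of D] counts[of a _ D]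
    by (intro ext_ge_if_counts[OF lin]) (auto simp: U L_def K_def)
  have a0U: "a0 \<in> U_deg n P I D" for D using a0(1) by (simp add: U L_a0)
  have "max_ext_mono n r P I D = dl (K D)" for D
    unfolding max_ext_mono_def
  proof (rule the_equality)
    have in_im: "dl (K D) \<in> init_ext_mono n r P I D ` U_deg n P I D"
      using a0U[of D] init_ext[OF a0U, of D] L_a0[of D] by (metis imageI)
    then show *: "dl (K D) \<in> init_ext_mono n r P I D ` U_deg n P I D \<and>
        (\<forall>ms'\<in>init_ext_mono n r P I D ` U_deg n P I D. ext_ge r (dl (K D)) ms')"
      using ge init_ext by auto
    show "ms = dl (K D)" if "ms \<in> init_ext_mono n r P I D ` U_deg n P I D \<and>
        (\<forall>ms'\<in>init_ext_mono n r P I D ` U_deg n P I D. ext_ge r ms ms')" for ms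
      using that * in_im ext_ge_antisym[OF lin] by blast
  qed
  then have "V_deg n r P I D = {a \<in> P. L D a = K D}" for D
    using dl[OF fin(1) sub(1), of D] dl[OF fin(2) sub(2), of D] init_ext
    by (auto simp: V_deg_def U) (metis | blast)+
  then show "V_set n r P I =
      {a \<in> P. \<forall>D. leads r (I a) \<inter> monomials_deg (xvars n) D = M \<inter> monomials_deg (xvars n) D}"
    and "a0 \<in> V_set n r P I"
    using a0(1) L_a0 by (auto simp: V_set_def L_def K_def)
qed

section \<open>Linear algebra over the ring of parameters\<close>

text \<open>With more unknowns than equations, zero rows pad the matrix to a square one. Row
  \<open>q\<close> is zero, hence so is the determinant, and over an integral domain this yields a
  nonzero kernel vector.\<close>

lemma ex_kernel_polys:
  fixes A :: "nat \<Rightarrow> nat \<Rightarrow> 'k::field mpoly"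
  assumes A: "\<And>i j. A i j \<in> polys T" and qp: "q < p"
  shows "\<exists>c. (\<forall>j. c j \<in> polys T) \<and> (\<exists>j<p. c j \<noteq> 0) \<and> (\<forall>i<q. (\<Sum>j<p. A i j * c j) = 0)"
proof -
  define B where "B = mat p p (\<lambda>(i, j). if i < q then A i j else 0)"
  have B: "B \<in> carrier_mat p p" by (simp add: B_def)
  have "(\<Prod>i = 0..<p. B $$ (i, \<pi> i)) = 0" if "\<pi> permutes {0..<p}" for \<pi>
  proof (rule prod_zero)
    have "\<pi> q < p" using permutes_in_image[OF that, of q] qp by simp
    then show "\<exists>i\<in>{0..<p}. B $$ (i, \<pi> i) = 0" using qp by (auto simp: B_def intro!: bexI[of _ q])
  qed simp
  then have "det B = 0"
    unfolding det_def'[OF B] by (intro sum.neutral ballI) (simp only: mem_Collect_eq mult_zero_right)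
  then obtain v where v: "v \<in> carrier_vec p" "v \<noteq> 0\<^sub>v p" "B *\<^sub>v v = 0\<^sub>v p"
    using det_0_iff_vec_prod_zero[OF B] by blast
  have "\<exists>j<p. v $ j \<noteq> 0"
  proof (rule ccontr)
    assume "\<not> (\<exists>j<p. v $ j \<noteq> 0)"
    then have "v = 0\<^sub>v p" using v(1) by (intro eq_vecI) auto
    then show False using v(2) by simp
  qed
  then obtain j0 where j0: "j0 < p" "v $ j0 \<noteq> 0" by blast
  \<comment> \<open>The kernel vector may involve variables outside \<open>T\<close>; any coefficient of it
    with respect to these variables is again in the kernel.\<close>
  obtain w where w: "coeff_at (- T) w (v $ j0) \<noteq> 0" using coeff_at_nonzero_ex[OF j0(2)] by blast
  define c where "c = (\<lambda>j. coeff_at (- T) w (v $ j))"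
  have "c j \<in> polys T" for j
    using coeff_at_polys[of "v $ j" UNIV "- T"] by (simp add: c_def polys_def monomials_def)
  moreover have "(\<Sum>j<p. A i j * c j) = 0" if "i < q" for i
  proof -
    have "(\<Sum>j<p. A i j * v $ j) = (B *\<^sub>v v) $ i"
      using that qp v(1) by (auto simp: B_def scalar_prod_def atLeast0LessThan intro!: sum.cong)
    also have "\<dots> = 0" using v(3) that qp by simp
    finally have "coeff_at (- T) w (\<Sum>j<p. A i j * v $ j) = 0" by simp
    then show ?thesis using A by (simp add: coeff_at_sum coeff_at_mult c_def)
  qed
  moreover have "c j0 \<noteq> 0" using w by (simp add: c_def)
  ultimately show ?thesis using j0(1) by blast
qed

text \<open>At \<open>a\<close> the determinant is a product of nonzero diagonal entries; it is then
  nonzero before specialization, which excludes nonzero kernel vectors over an integral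
  domain.\<close>

lemma kernel_trivial_if_specialized_triangular:
  fixes B :: "nat \<Rightarrow> nat \<Rightarrow> 'k::field mpoly"
  assumes upper: "\<And>i j. i < j \<Longrightarrow> j < p \<Longrightarrow> specialize a (B i j) = 0"
    and diag: "\<And>i. i < p \<Longrightarrow> specialize a (B i i) \<noteq> 0"
    and ker: "\<And>i. i < p \<Longrightarrow> (\<Sum>j<p. B i j * c j) = 0"
    and "j < p"
  shows "c j = 0"
proof -
  interpret specialize: comm_ring_hom "specialize a :: 'k mpoly \<Rightarrow> 'k mpoly"
    by (rule comm_ring_hom_specialize)
  define M where "M = mat p p (\<lambda>(i, j). B i j)"
  have M: "M \<in> carrier_mat p p" by (simp add: M_def)
  have "specialize a (det M) = det (map_mat (specialize a) M)" by (simp add: specialize.hom_det)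
  also have "\<dots> = prod_list (diag_mat (map_mat (specialize a) M))"
    by (rule det_lower_triangular[of p]) (auto simp: M_def upper)
  also have "\<dots> \<noteq> 0"
    using diag by (auto simp: prod_list_zero_iff diag_mat_def M_def)
  finally have "det M \<noteq> 0" by auto
  moreover have "M *\<^sub>v vec p c = 0\<^sub>v p"
    using ker by (intro eq_vecI) (auto simp: M_def scalar_prod_def atLeast0LessThan)
  ultimately have "vec p c = 0\<^sub>v p"
    using det_0_iff_vec_prod_zero[OF M] vec_carrier[of p c] by blast
  then show ?thesis using \<open>j < p\<close> by (metis index_vec index_zero_vec(1))
qed

section \<open>Groebner bases with respect to inverse block orders\<close>

text \<open>Monomials with the same part in x differ in their part in t, so no cancellation occurs
  in a coefficient.\<close>

lemma x_coeff_nonzero_iff: "x_coeff p v \<noteq> 0 \<longleftrightarrow> v \<in> xpart ` keys p"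
proof
  assume "x_coeff p v \<noteq> 0"
  then obtain u where "lookup (x_coeff p v) u \<noteq> 0" by (metis lookup_zero poly_mapping_eqI)
  then have *: "keys u \<inter> range XVar = {}" "keys v \<subseteq> range XVar" "u + v \<in> keys p"
    by (auto simp: x_coeff_eq lookup_coeff_at in_keys_iff split: if_splits)
  then have "xpart (u + v) = v"
    by (simp add: xpart_def restrict_mono_add restrict_mono_id restrict_mono_eq_0)
  then show "v \<in> xpart ` keys p" using *(3) by force
next
  assume "v \<in> xpart ` keys p"
  then obtain m where m: "m \<in> keys p" "v = xpart m" by blast
  have "lookup (x_coeff p v) (tpart m) = lookup p m"
    using restrict_mono_split[of "range XVar" m]
    by (auto simp: x_coeff_eq lookup_coeff_at m xpart_def tpart_def keys_restrict_mono add.commute)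
  then show "x_coeff p v \<noteq> 0" using m(1) by (auto simp: in_keys_iff)
qed

text \<open>Isolates what the argument takes from the generic forms: each generator is homogeneous
  in x, with coefficients in the parameters.\<close>

locale inverse_block_groebner =
  fixes T X :: "var set" and rt rx r' :: "mono rel" and F G :: "'k::field mpoly set"
  assumes T: "T \<inter> range XVar = {}" and X: "X \<subseteq> range XVar"
    and rt: "monomial_order T rt" and rx: "monomial_order X rx"
    and r': "r' = inverse_block_order T X rt rx"
    and F: "F \<subseteq> polys (T \<union> X)" "\<And>f. f \<in> F \<Longrightarrow> \<exists>d. \<forall>m\<in>keys f. mdeg (xpart m) = d"
    and G: "groebner_basis (T \<union> X) r' (ideal_gen (T \<union> X) F) G"
begin

abbreviation J :: "'k mpoly set" where
  "J \<equiv> ideal_gen (T \<union> X) F"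

definition spec :: "(nat \<times> nat \<Rightarrow> 'k) \<Rightarrow> 'k mpoly set" where
  "spec a = ideal_gen X (specialize a ` F)"

definition M :: "mono set" where
  "M = {w + LM_x rx g | w g. w \<in> monomials X \<and> g \<in> G}"

lemma J_polys: "J \<subseteq> polys (T \<union> X)"
  by (rule ideal_gen_polys[OF F(1)])

lemma G_J: "finite G" "g \<in> G \<Longrightarrow> g \<in> J" "g \<in> G \<Longrightarrow> g \<noteq> 0"
  using G by (auto simp: groebner_basis_def)

section \<open>Leading monomials for the inverse block order\<close>

lemma xpart_mono: "m \<in> monomials (T \<union> X) \<Longrightarrow> xpart m \<in> monomials X"
  using T by (auto simp: monomials_def xpart_def keys_restrict_mono)

lemma tpart_mono: "m \<in> monomials (T \<union> X) \<Longrightarrow> tpart m \<in> monomials T"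
  using X by (auto simp: monomials_def tpart_def keys_restrict_mono)

lemma in_r'_iff:
  "(m, m') \<in> r' \<longleftrightarrow> m \<in> monomials (T \<union> X) \<and> m' \<in> monomials (T \<union> X) \<and>
     ((xpart m, xpart m') \<in> rx \<and> xpart m \<noteq> xpart m' \<or>
      xpart m = xpart m' \<and> (tpart m, tpart m') \<in> rt)"
proof
  have parts: "xpart (u + v) = v" "tpart (u + v) = u" "u + v \<in> monomials (T \<union> X)"
    if "u \<in> monomials T" "v \<in> monomials X" for u v
  proof -
    have k: "keys u \<inter> range XVar = {}" "keys v \<subseteq> range XVar" "keys u \<subseteq> - range XVar"
      "keys v \<inter> - range XVar = {}"
      using that T X by (auto simp: monomials_def)
    show "xpart (u + v) = v" "tpart (u + v) = u"
      using k by (simp_all only: xpart_def tpart_def restrict_mono_add restrict_mono_id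
          restrict_mono_eq_0 add_0_left add_0_right)
    show "u + v \<in> monomials (T \<union> X)"
      using that monomials_mono[of T "T \<union> X"] monomials_mono[of X "T \<union> X"]
      by (intro monomials_add) auto
  qed
  {
    assume "(m, m') \<in> r'"
    then obtain u1 v1 u2 v2 where "m = u1 + v1" "m' = u2 + v2" "u1 \<in> monomials T"
      "u2 \<in> monomials T" "v1 \<in> monomials X" "v2 \<in> monomials X"
      "(v1, v2) \<in> rx \<and> v1 \<noteq> v2 \<or> v1 = v2 \<and> (u1, u2) \<in> rt"
      unfolding r' inverse_block_order_def by blast
    then show "m \<in> monomials (T \<union> X) \<and> m' \<in> monomials (T \<union> X) \<and>
     ((xpart m, xpart m') \<in> rx \<and> xpart m \<noteq> xpart m' \<or>
      xpart m = xpart m' \<and> (tpart m, tpart m') \<in> rt)"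
      using parts by auto
  }
  {
    assume *: "m \<in> monomials (T \<union> X) \<and> m' \<in> monomials (T \<union> X) \<and>
     ((xpart m, xpart m') \<in> rx \<and> xpart m \<noteq> xpart m' \<or>
      xpart m = xpart m' \<and> (tpart m, tpart m') \<in> rt)"
    have "m = tpart m + xpart m" for m
      using restrict_mono_split[of "range XVar" m] by (simp add: xpart_def tpart_def add.commute)
    then show "(m, m') \<in> r'"
      unfolding r' inverse_block_order_def using * xpart_mono tpart_mono by blast
  }
qed

lemma rx_linear: "linear_order_on (monomials X) rx"
  by (rule monomial_order_linear[OF rx])

text \<open>The order is the lexicographic product of two linear orders, along the unique splitting
  of a monomial into its parts in x and t.\<close>

lemma r'_linear: "linear_order_on (monomials (T \<union> X)) r'"
proof -
  note x = linear_order_onD[OF rx_linear]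
  note t = linear_order_onD[OF monomial_order_linear[OF rt]]
  have eq: "m = m'" if "xpart m = xpart m'" "tpart m = tpart m'" for m m'
    using that restrict_mono_split[of "range XVar"] by (metis xpart_def tpart_def)
  have "r' \<subseteq> monomials (T \<union> X) \<times> monomials (T \<union> X)" by (auto simp: in_r'_iff)
  moreover have "refl_on (monomials (T \<union> X)) r'"
    by (auto simp: refl_on_def in_r'_iff intro: t tpart_mono)
  moreover have "trans r'"
    by (rule transI) (simp add: in_r'_iff, metis x(2,3) t(2))
  moreover have "antisym r'"
    by (rule antisymI) (simp add: in_r'_iff, metis x(3) t(3) eq)
  moreover have "total_on (monomials (T \<union> X)) r'"
    unfolding total_on_def in_r'_iff using x(4) t(4) xpart_mono tpart_mono by metis
  ultimately show ?thesis by (simp add: order_on_defs)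
qed

text \<open>Parts in x are compared first, so \<open>xpart\<close> is monotone from
  \<open>r'\<close> to \<open>rx\<close> and carries the greatest monomial of \<open>p\<close> to
  the greatest part in x.\<close>

lemma
  assumes "p \<in> polys (T \<union> X)" "p \<noteq> 0"
  shows LM_x_nonzero: "x_coeff p (LM_x rx p) \<noteq> 0"
    and LM_x_ge: "x_coeff p v \<noteq> 0 \<Longrightarrow> (v, LM_x rx p) \<in> rx"
    and LM_x_mono: "LM_x rx p \<in> monomials X"
    and xpart_lead: "xpart (greatest r' (keys p)) = LM_x rx p"
proof -
  define A where "A = {v. x_coeff p v \<noteq> 0}"
  have A: "A = xpart ` keys p" by (auto simp: A_def x_coeff_nonzero_iff)
  have kp: "keys p \<subseteq> monomials (T \<union> X)" using assms(1) by (simp add: polys_def)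
  have AX: "A \<subseteq> monomials X" using kp xpart_mono by (auto simp: A)
  have LM: "LM_x rx p = greatest rx A" by (simp add: LM_x_def A_def)
  have "finite A" "A \<noteq> {}" using assms(2) by (auto simp: A)
  note g = greatest_in[OF rx_linear this AX] greatest_ge[OF rx_linear this AX]
  show "x_coeff p (LM_x rx p) \<noteq> 0" "x_coeff p v \<noteq> 0 \<Longrightarrow> (v, LM_x rx p) \<in> rx"
    "LM_x rx p \<in> monomials X"
    using g AX unfolding LM by (auto simp: A_def)
  show "xpart (greatest r' (keys p)) = LM_x rx p"
    unfolding LM
  proof (rule greatest_eqI[OF rx_linear, symmetric])
    note l = lead_in_keys[OF r'_linear assms] lead_ge[OF r'_linear assms]
    show "xpart (greatest r' (keys p)) \<in> A" using l(1) by (simp add: A)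
    fix v assume "v \<in> A"
    then obtain m where m: "m \<in> keys p" "v = xpart m" by (auto simp: A)
    then show "(v, xpart (greatest r' (keys p))) \<in> rx"
      using l(2)[OF m(1)] linear_order_onD(1)[OF rx_linear] xpart_mono kp
      by (auto simp: in_r'_iff)
  qed
qed

text \<open>The leading monomial of \<open>f\<close> for \<open>r'\<close> is a multiple of that of
  some element of \<open>G\<close>. The cofactor may contain parameters, which \<open>xpart\<close>
  discards.\<close>

lemma LM_x_in_M:
  assumes "f \<in> J" "f \<noteq> 0"
  shows "LM_x rx f \<in> M"
proof -
  define m where "m = greatest r' (keys f)"
  have f: "f \<in> polys (T \<union> X)" using assms(1) J_polys by auto
  have "lookup f m \<noteq> 0"
    using lead_in_keys[OF r'_linear f assms(2)] by (simp add: m_def in_keys_iff)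
  then have "m \<in> keys (init_term r' f)" by (simp add: init_term_def m_def)
  moreover have "init_term r' f \<in> ideal_gen (T \<union> X) (init_term r' ` G)"
    using G assms by (auto simp: groebner_basis_def initial_ideal_def intro: kspace.span_base)
  ultimately obtain w g m' where *: "w \<in> monomials (T \<union> X)" "g \<in> G"
    "m' \<in> keys (init_term r' g)" "m = w + m'"
    using keys_ideal_gen by blast
  have "m' = greatest r' (keys g)" using *(3) by (auto simp: init_term_def split: if_splits)
  then have "xpart m' = LM_x rx g" using xpart_lead G_J(2,3)[OF *(2)] J_polys by auto
  moreover have "xpart m = LM_x rx f" unfolding m_def by (rule xpart_lead[OF f assms(2)])
  ultimately have "LM_x rx f = xpart w + LM_x rx g" by (simp add: *(4) xpart_add)
  then show ?thesis using xpart_mono[OF *(1)] *(2) by (auto simp: M_def)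
qed

section \<open>Specialized ideals and lifts\<close>

lemma spec_polys: "spec a \<subseteq> polys X"
  unfolding spec_def
  by (rule ideal_gen_polys) (use F(1) specialize_polys[OF _ X T] in auto)

lemma spec_x_comp: "p \<in> spec a \<Longrightarrow> x_comp D p \<in> spec a"
  unfolding spec_def
proof (erule ideal_gen_x_comp)
  fix g assume "g \<in> specialize a ` F"
  then obtain f where f: "f \<in> F" "g = specialize a f" by blast
  then obtain d where d: "\<And>m. m \<in> keys f \<Longrightarrow> mdeg (xpart m) = d" using F(2) by blast
  have "mdeg (xpart v) = d" if "v \<in> keys g" for v
  proof -
    have "specialize a (x_coeff f v) \<noteq> 0"
      using that by (simp add: specialize_x_coeff f(2) in_keys_iff)
    then have "x_coeff f v \<noteq> 0" by auto
    then show ?thesis using d xpart_x_coeff[of f v] by (auto simp: x_coeff_nonzero_iff)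
  qed
  then show "\<exists>d. \<forall>m\<in>keys g. mdeg (xpart m) = d" by blast
qed

lemma specialize_J: "h \<in> J \<Longrightarrow> specialize a h \<in> spec a"
  unfolding spec_def
proof (induction h rule: ideal_gen_induct)
  case (mult m c g)
  then show ?case using xpart_mono
    by (auto simp: specialize_mult specialize_single intro!: ideal_gen_gen_mult polys_single)
qed (auto simp: specialize_add intro: ideal_gen_zero ideal_gen_add)

text \<open>Terms in x are fixed by specialization, so a multiple of a specialized generator lifts
  to the same multiple of the generator.\<close>

lemma specialize_lift:
  assumes "f \<in> spec a"
  shows "\<exists>h\<in>J. specialize a h = f"
  using assms unfolding spec_def
proof (induction f rule: ideal_gen_induct)
  case zero
  then show ?case using ideal_gen_zero by force
next
  case (add p q)
  then show ?case by (metis ideal_gen_add specialize_add)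
next
  case (mult m c g)
  then obtain f where f: "f \<in> F" "g = specialize a f" by blast
  have m: "m \<in> monomials (T \<union> X)" "keys m \<subseteq> range XVar"
    using mult(1) X by (auto simp: monomials_def)
  have "single m c * f \<in> J" using f(1) m(1) by (intro ideal_gen_gen_mult polys_single)
  moreover have "specialize a (single m c * f) = single m c * g"
    using m(2) by (simp add: specialize_mult specialize_x_mono f(2))
  ultimately show ?case by blast
qed

text \<open>Otherwise lifts of elements of \<open>spec a\<close> with the leading monomials on the left would have a
  nontrivial combination over the ring of parameters in which all monomials on the right are
  cancelled, although its leading monomial lies in \<open>M\<close>. The lifts are independent on the monomials
  on the left since the determinant of the coefficients does not vanish at \<open>a\<close>.\<close>

lemma card_leads_spec_le:
  assumes "finite X" "m \<in> monomials X"
  shows "card {u \<in> leads rx (spec a) \<inter> monomials_deg X D. (m, u) \<in> rx} \<le>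
    card {u \<in> M \<inter> monomials_deg X D. (m, u) \<in> rx}" (is "card ?L \<le> card ?Q")
proof (rule ccontr)
  assume "\<not> ?thesis"
  then have less: "card ?Q < card ?L" by simp
  note x = linear_order_onD[OF rx_linear]
  have sub: "?L \<subseteq> monomials X" "?Q \<subseteq> monomials X" by (auto simp: monomials_deg_def)
  have fin: "finite ?L" "finite ?Q" using finite_monomials_deg[OF assms(1), of D] by auto
  obtain us where us: "set us = ?L" "decreasing rx us"
    using ex_decreasing[OF rx_linear fin(1) sub(1)] by blast
  obtain ms where ms: "set ms = ?Q" "decreasing rx ms"
    using ex_decreasing[OF rx_linear fin(2) sub(2)] by blast
  define p where "p = length us"
  define q where "q = length ms"
  have qp: "q < p"
    using less us ms distinct_card[OF decreasing_distinct[OF rx_linear us(2)]]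
      distinct_card[OF decreasing_distinct[OF rx_linear ms(2)]] by (simp add: p_def q_def)
  have us_in: "us ! j \<in> ?L" if "j < p" for j using that us(1) nth_mem[of j us] by (simp add: p_def)
  have "\<exists>h\<in>J. specialize a h \<noteq> 0 \<and> greatest rx (keys (specialize a h)) = us ! j" if j: "j < p" for j
  proof -
    obtain f where "f \<in> spec a - {0}" "us ! j = greatest rx (keys f)"
      using us_in[OF j] unfolding leads_def by blast
    then show ?thesis using specialize_lift[of f a] by auto
  qed
  then obtain h where h: "\<And>j. j < p \<Longrightarrow>
      h j \<in> J \<and> specialize a (h j) \<noteq> 0 \<and> greatest rx (keys (specialize a (h j))) = us ! j"
    by metis
  have hX: "specialize a (h j) \<in> polys X" if "j < p" for j
    using specialize_J h[OF that] spec_polys by blast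
  \<comment> \<open>Row \<open>i\<close> asks that the combination have no monomial
    \<open>ms ! i\<close> in x. The value 0 for \<open>j \<ge> p\<close>, where \<open>h j\<close>
    is unspecified, puts every entry in \<open>polys T\<close>.\<close>
  define A where "A = (\<lambda>i j. if j < p then x_coeff (h j) (ms ! i) else 0)"
  have "A i j \<in> polys T" for i j
  proof (cases "j < p")
    case True
    then have "A i j \<in> polys ((T \<union> X) - range XVar)"
      unfolding A_def x_coeff_eq using h[OF True] J_polys by (auto intro!: coeff_at_polys)
    then show ?thesis using polys_mono[of "(T \<union> X) - range XVar" T] X by auto
  qed (simp add: A_def)
  from ex_kernel_polys[of A T, OF this qp] obtain c where
    c: "\<And>j. c j \<in> polys T" "\<exists>j<p. c j \<noteq> 0" "\<And>i. i < q \<Longrightarrow> (\<Sum>j<p. A i j * c j) = 0"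
    by blast
  define h0 where "h0 = (\<Sum>j<p. c j * h j)"
  have cJ: "c j \<in> polys (T \<union> X)" "c j \<in> polys (- range XVar)" for j
    using c(1)[of j] polys_mono[of T "T \<union> X"] polys_mono[of T "- range XVar"] T by auto
  have h0J: "h0 \<in> J" unfolding h0_def using h cJ by (intro ideal_gen_sum ideal_gen_mult) auto
  have coeff_h0: "x_coeff h0 v = (\<Sum>j<p. x_coeff (h j) v * c j)" for v
    unfolding h0_def x_coeff_eq coeff_at_sum
    by (intro sum.cong refl) (simp add: coeff_at_mult[OF cJ(2)] mult.commute)
  \<comment> \<open>The lifts need not be homogeneous in x. The component of degree \<open>D\<close>
    keeps the coefficients at the monomials \<open>us ! i\<close> and forces its leading monomial
    into degree \<open>D\<close>.\<close>
  define h1 where "h1 = x_comp D h0"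
  have h1J: "h1 \<in> J" unfolding h1_def using h0J F(2) by (rule ideal_gen_x_comp)
  have coeff_h1: "x_coeff h1 v = (if mdeg v = D then x_coeff h0 v else 0)" for v
    by (simp add: h1_def x_coeff_x_comp)
  have "(\<Sum>j<p. x_coeff (h j) (us ! i) * c j) = 0" if i: "i < p" for i
  proof (rule ccontr)
    assume ne: "(\<Sum>j<p. x_coeff (h j) (us ! i) * c j) \<noteq> 0"
    have "mdeg (us ! i) = D" using us_in[OF i] by (simp add: monomials_deg_def)
    then have ne1: "x_coeff h1 (us ! i) \<noteq> 0" using ne by (simp add: coeff_h1 coeff_h0)
    then have "h1 \<noteq> 0" by (auto simp: x_coeff_eq)
    have h1W: "h1 \<in> polys (T \<union> X)" using h1J J_polys by auto
    define v where "v = LM_x rx h1"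
    have v: "x_coeff h1 v \<noteq> 0" "(us ! i, v) \<in> rx" "v \<in> monomials X" "v \<in> M"
      unfolding v_def using LM_x_nonzero[OF h1W \<open>h1 \<noteq> 0\<close>] LM_x_ge[OF h1W \<open>h1 \<noteq> 0\<close> ne1]
        LM_x_mono[OF h1W \<open>h1 \<noteq> 0\<close>] LM_x_in_M[OF h1J \<open>h1 \<noteq> 0\<close>] by auto
    \<comment> \<open>\<open>v\<close> lies at or above \<open>us ! i\<close>, hence at or above
      \<open>m\<close>; it is thus one of the monomials in \<open>ms\<close>, whose coefficients
      were cancelled.\<close>
    have "(m, us ! i) \<in> rx" using us_in[OF i] by simp
    then have "(m, v) \<in> rx" using x(2) v(2) by blast
    moreover have "mdeg v = D" using v(1) coeff_h1[of v] by (auto split: if_splits)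
    ultimately have "v \<in> set ms" using v(3,4) ms(1) by (auto simp: monomials_deg_def)
    then obtain k where "k < q" "v = ms ! k" by (auto simp: in_set_conv_nth q_def)
    then have "x_coeff h0 v = 0"
      using c(3)[of k] by (simp add: coeff_h0 A_def)
    then show False using v(1) by (simp add: coeff_h1 split: if_splits)
  qed
  moreover have "specialize a (x_coeff (h i) (us ! i)) \<noteq> 0" if "i < p" for i
    using lead_in_keys[OF rx_linear hX[OF that]] h[OF that]
    by (auto simp: specialize_x_coeff in_keys_iff)
  \<comment> \<open>The list decreases, so \<open>us ! i\<close> exceeds the leading monomial of the
    specialized \<open>h j\<close>: at \<open>a\<close> the matrix is lower triangular.\<close>
  moreover have "specialize a (x_coeff (h j) (us ! i)) = 0" if "i < j" "j < p" for i j
  proof -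
    have "(us ! j, us ! i) \<in> rx" "us ! i \<noteq> us ! j"
      using us(2) that by (auto simp: sorted_wrt_iff_nth_less p_def)
    then have "us ! i \<notin> keys (specialize a (h j))"
      using lead_ge[OF rx_linear hX[OF that(2)], of "us ! i"] h[OF that(2)] x(3) by auto
    then show ?thesis by (simp add: specialize_x_coeff in_keys_iff)
  qed
  ultimately have "c j = 0" if "j < p" for j
    using that kernel_trivial_if_specialized_triangular[of p a "\<lambda>i j. x_coeff (h j) (us ! i)" c j]
    by blast
  then show False using c(2) by blast
qed

text \<open>The product of the finitely many leading coefficients is one nonzero polynomial in the
  parameters, so a single point serves all of \<open>G\<close>.\<close>

lemma ex_M_subset_leads:
  assumes "infinite (UNIV :: 'k set)" "finite P" "T = (\<lambda>(j, k). TVar j k) ` P"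
  shows "\<exists>a\<in>P \<rightarrow>\<^sub>E UNIV. M \<subseteq> leads rx (spec a)"
proof -
  define lc :: "'k mpoly \<Rightarrow> 'k mpoly" where "lc = (\<lambda>g. x_coeff g (LM_x rx g))"
  have gW: "g \<in> polys (T \<union> X)" "g \<noteq> 0" if "g \<in> G" for g using G_J(2,3)[OF that] J_polys by auto
  have lcT: "lc g \<in> polys T" if "g \<in> G" for g
  proof -
    have "lc g \<in> polys ((T \<union> X) - range XVar)"
      unfolding lc_def x_coeff_eq using gW(1)[OF that] by (rule coeff_at_polys)
    then show ?thesis using polys_mono[of "(T \<union> X) - range XVar" T] X by auto
  qed
  have "prod lc H \<in> polys T" if "finite H" "H \<subseteq> G" for H
    using that
  proof (induction H rule: finite_induct)
    case empty
    have "single 0 (1 :: 'k) \<in> polys T" by (rule polys_single) simp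
    then show ?case by simp
  qed (simp add: lcT polys_mult)
  moreover have "prod lc G \<noteq> 0"
    using LM_x_nonzero gW G_J(1) by (auto simp: prod_zero_iff lc_def)
  ultimately obtain a where a: "a \<in> P \<rightarrow>\<^sub>E UNIV" "specialize a (prod lc G) \<noteq> 0"
    using specialize_nonzero_ex[OF assms(1,2), of "prod lc G"] G_J(1) assms(3) by auto
  have "M \<subseteq> leads rx (spec a)"
  proof
    fix m assume "m \<in> M"
    then obtain w g where m: "m = w + LM_x rx g" "w \<in> monomials X" "g \<in> G" by (auto simp: M_def)
    have "prod lc G = lc g * prod lc (G - {g})" using G_J(1) m(3) by (rule prod.remove)
    then have "specialize a (lc g) \<noteq> 0" using a(2) by (auto simp: specialize_mult)
    then have key: "LM_x rx g \<in> keys (specialize a g)"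
      by (auto simp: lc_def specialize_x_coeff in_keys_iff)
    \<comment> \<open>A monomial of the specialized \<open>g\<close> comes from a nonzero
      coefficient of \<open>g\<close>, so nothing rises above the surviving leading
      monomial.\<close>
    have "(v, LM_x rx g) \<in> rx" if "v \<in> keys (specialize a g)" for v
    proof -
      have "specialize a (x_coeff g v) \<noteq> 0"
        using that by (simp add: specialize_x_coeff in_keys_iff)
      then have "x_coeff g v \<noteq> 0" by (metis specialize_zero)
      then show ?thesis by (rule LM_x_ge[OF gW[OF m(3)]])
    qed
    then have "greatest rx (keys (specialize a g)) = LM_x rx g"
      using key by (intro greatest_eqI[OF rx_linear])
    moreover have "specialize a g \<in> spec a - {0}" using key specialize_J G_J(2) m(3) by auto
    ultimately have "LM_x rx g \<in> leads rx (spec a)" unfolding leads_def by force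
    then show "m \<in> leads rx (spec a)"
      unfolding m(1) using m(2) spec_polys
      by (intro leads_add[OF rx]) (auto simp: spec_def intro!: ideal_gen_mult polys_single)
  qed
  then show ?thesis using a(1) by blast
qed

end

section \<open>Generic forms\<close>

lemma keys_generic_form:
  "keys (generic_form n d e j :: 'k::comm_ring_1 mpoly) \<subseteq>
    (\<lambda>k. single (TVar j k) 1 + e j k) ` {1..num_params n d j}"
proof
  fix m assume "m \<in> keys (generic_form n d e j :: 'k mpoly)"
  then have "(\<Sum>k=1..num_params n d j.
      lookup (single (single (TVar j k) 1 + e j k) (1 :: 'k)) m) \<noteq> 0"
    by (simp add: generic_form_def in_keys_iff lookup_sum)
  from sum.not_neutral_contains_not_neutral[OF this] obtain k where
    "k \<in> {1..num_params n d j}" "lookup (single (single (TVar j k) 1 + e j k) (1 :: 'k)) m \<noteq> 0" .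
  moreover from this(2) have "m = single (TVar j k) 1 + e j k"
    by (simp add: lookup_single when_def split: if_splits)
  ultimately show "m \<in> (\<lambda>k. single (TVar j k) 1 + e j k) ` {1..num_params n d j}"
    by (intro image_eqI)
qed

theorem theorem3p9:
  fixes n s :: nat and d :: "nat \<Rightarrow> nat" and e :: "nat \<Rightarrow> nat \<Rightarrow> mono"
    and rt rx r' :: "mono rel" and G :: "'k::field mpoly set"
  assumes "infinite (UNIV :: 'k set)"
    and "n > 0" and "s > 0" and "\<forall>j\<in>{1..s}. d j > 0"
    and "enumerates_monomials n s d e"
    and "monomial_order (tvars n s d) rt"
    and "monomial_order (xvars n) rx"
    and "r' = inverse_block_order (tvars n s d) (xvars n) rt rx"
    and "\<forall>i j. 1 \<le> i \<and> i \<le> j \<and> j \<le> n \<longrightarrow> (single (XVar j) 1, single (XVar i) 1) \<in> rx"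
    and "groebner_basis (tvars n s d \<union> xvars n) r' (generic_ideal n s d e) G"
  shows "(V_generic n s d e rx :: (nat \<times> nat \<Rightarrow> 'k) set) \<noteq> {} \<and>
    (\<forall>a \<in> (V_generic n s d e rx :: (nat \<times> nat \<Rightarrow> 'k) set).
       ideal_gen (xvars n) ((\<lambda>g. single (LM_x rx g) (1::'k)) ` G) = initial_ideal rx (spec_ideal n s d e a))"
proof -
  let ?X = "xvars n" and ?T = "tvars n s d"
  define F :: "'k mpoly set" where "F = generic_form n d e ` {1..s}"
  have e: "e j k \<in> monomials_deg ?X (d j)" if "j \<in> {1..s}" "k \<in> {1..num_params n d j}" for j k
    using assms(5) that bij_betwE[of "e j"] unfolding enumerates_monomials_def by blast
  have fin: "finite ?X" "finite (param_index n s d)" by (auto simp: xvars_def param_index_def)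
  interpret inverse_block_groebner ?T ?X rt rx r' F G
  proof
    show "?T \<inter> range XVar = {}" by (auto simp: tvars_def)
    show "?X \<subseteq> range XVar" by (auto simp: xvars_def)
    show "F \<subseteq> polys (?T \<union> ?X)"
    proof
      fix f assume "f \<in> F"
      then obtain j where j: "j \<in> {1..s}" "f = generic_form n d e j" unfolding F_def by blast
      have "m \<in> monomials (?T \<union> ?X)" if mk: "m \<in> keys f" for m
      proof -
        obtain k where k: "k \<in> {1..num_params n d j}" "m = single (TVar j k) 1 + e j k"
          using keys_generic_form[of n d e j, where ?'k = 'k] mk j(2) by blast
        have "single (TVar j k) 1 \<in> monomials (?T \<union> ?X)"
          using j(1) k(1) by (auto simp: monomials_def tvars_def param_index_def)
        moreover have "e j k \<in> monomials (?T \<union> ?X)"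
          using e[OF j(1) k(1)] by (auto simp: monomials_deg_def monomials_def)
        ultimately show ?thesis unfolding k(2) by (rule monomials_add)
      qed
      then show "f \<in> polys (?T \<union> ?X)" by (auto simp: polys_def)
    qed
    fix f assume "f \<in> F"
    then obtain j where j: "j \<in> {1..s}" "f = generic_form n d e j" unfolding F_def by blast
    have "mdeg (xpart m) = d j" if mk: "m \<in> keys f" for m
    proof -
      obtain k where k: "k \<in> {1..num_params n d j}" "m = single (TVar j k) 1 + e j k"
        using keys_generic_form[of n d e j, where ?'k = 'k] mk j(2) by blast
      have "keys (e j k) \<subseteq> range XVar"
        using e[OF j(1) k(1)] by (auto simp: monomials_deg_def monomials_def xvars_def)
      moreover have "xpart (single (TVar j k) 1) = 0"
        unfolding xpart_def by (rule restrict_mono_eq_0) auto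
      ultimately have "xpart m = e j k" by (simp add: k(2) xpart_add xpart_id)
      then show ?thesis using e[OF j(1) k(1)] by (simp add: monomials_deg_def)
    qed
    then show "\<exists>d. \<forall>m\<in>keys f. mdeg (xpart m) = d" by blast
  qed (use assms in \<open>auto simp: generic_ideal_def F_def\<close>)
  have spec: "spec_ideal n s d e a = spec a" for a :: "nat \<times> nat \<Rightarrow> 'k"
    by (simp add: spec_ideal_def spec_def) (simp add: F_def image_image)
  let ?P = "param_space n s d :: (nat \<times> nat \<Rightarrow> 'k) set"
  obtain a0 where a0: "a0 \<in> ?P" "M \<subseteq> leads rx (spec a0)"
    using ex_M_subset_leads[OF assms(1) fin(2)] by (auto simp: tvars_def param_space_def)
  have sub: "kspace.subspace (spec a)" for a unfolding spec_def by (rule subspace_ideal_gen)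
  have V: "V_set n rx ?P spec =
      {a \<in> ?P. \<forall>D. leads rx (spec a) \<inter> monomials_deg ?X D = M \<inter> monomials_deg ?X D}"
    by (rule V_set_eq(1)[where I = spec and M = M, OF assms(7) _ _ _ _ a0];
        (rule spec_polys | rule sub | erule spec_x_comp | erule card_leads_spec_le[OF fin(1)]))
  have a0V: "a0 \<in> V_set n rx ?P spec"
    by (rule V_set_eq(2)[where I = spec and M = M, OF assms(7) _ _ _ _ a0];
        (rule spec_polys | rule sub | erule spec_x_comp | erule card_leads_spec_le[OF fin(1)]))
  have M: "M \<subseteq> monomials ?X"
  proof
    fix m assume "m \<in> M"
    then show "m \<in> monomials ?X"
      using G_J(2,3) J_polys LM_x_mono by (auto simp: M_def intro!: monomials_add)
  qed
  have leads: "leads rx (spec a) \<subseteq> monomials ?X" for a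
    by (rule leads_subset[OF rx_linear spec_polys])
  have V_iff: "a \<in> V_set n rx ?P spec \<longleftrightarrow> a \<in> ?P \<and> leads rx (spec a) = M" for a
  proof -
    \<comment> \<open>A set of monomials is the union of its graded pieces, so agreement in every
      degree is equality.\<close>
    have "N = N'" if "\<forall>D. N \<inter> monomials_deg ?X D = N' \<inter> monomials_deg ?X D"
      "N \<subseteq> monomials ?X" "N' \<subseteq> monomials ?X" for N N'
    proof -
      have "N = (\<Union>D. N \<inter> monomials_deg ?X D)" "N' = (\<Union>D. N' \<inter> monomials_deg ?X D)"
        using that(2,3) by (auto simp: monomials_deg_def)
      then show ?thesis using that(1) by simp
    qed
    then show ?thesis using M leads[of a] by (auto simp: V)
  qed
  \<comment> \<open>Both ideals consist of the polynomials all of whose monomials lie in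
    \<open>M\<close>.\<close>
  have "ideal_gen ?X ((\<lambda>g. single (LM_x rx g) (1::'k)) ` G) =
      initial_ideal rx (spec_ideal n s d e a)" if "a \<in> V_set n rx ?P spec" for a
    using that by (simp add: V_iff spec initial_ideal_eq[OF rx_linear spec_polys]
        ideal_gen_monomials M_def)
  then show ?thesis using a0V unfolding V_generic_def spec[abs_def] by blast
qed

end
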